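(* Let $\mathcal{T}_h^\times$ be the space of invertible hermitian $2\times 2$ Toeplitz matrices, i.e. invertible matrices of the form $\begin{pmatrix} a_0 & a_1+i a_2\\ a_1-i a_2 & a_0\end{pmatrix}$ with $a_0,a_1,a_2\in\mathbb{R}$, and let $M_2(\mathbb{C})_h^\times$ be the space of all invertible hermitian $2\times 2$ complex matrices. Then: (1) $\pi_1(\mathcal{T}_h^\times)\cong\mathbb{Z}$ at any base point of signature $0$, and $\pi_k(\mathcal{T}_h^\times)=0$ for all $k>1$ (at any base point); (2) $\pi_1(M_2(\mathbb{C})_h^\times)=0$ at any base point, and $\pi_2(M_2(\mathbb{C})_h^\times)\cong\mathbb{Z}$ at any base point of signature $0$.
   Context: Both spaces carry the norm topology. The signature of an invertible hermitian matrix is the number of positive eigenvalues minus the number of negative eigenvalues, counted with multiplicity. $\pi_k$ denotes the $k$-th homotopy group at the specified base point. *)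

theory Defs
  imports
    "HOL-Analysis.Analysis"
    "HOL-Algebra.Elementary_Groups"
    "HOL-Computational_Algebra.Polynomial"
begin

definition cube :: "nat \<Rightarrow> (nat \<Rightarrow> real) topology" where
  "cube k = product_topology (\<lambda>_. top_of_set {0..1}) {..<k}"

definition cube_boundary :: "nat \<Rightarrow> (nat \<Rightarrow> real) set" where
  "cube_boundary k = {t \<in> topspace (cube k). \<exists>i<k. t i = 0 \<or> t i = 1}"

definition based_map :: "nat \<Rightarrow> 'a \<Rightarrow> ((nat \<Rightarrow> real) \<Rightarrow> 'a) \<Rightarrow> bool" where
  "based_map k x f \<longleftrightarrow> (\<forall>t \<in> cube_boundary k. f t = x)"

definition cube_maps :: "nat \<Rightarrow> 'a topology \<Rightarrow> 'a \<Rightarrow> ((nat \<Rightarrow> real) \<Rightarrow> 'a) set" where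
  "cube_maps k X x = {f. continuous_map (cube k) X f \<and> based_map k x f}"

text \<open>Maps that agree on the cube but differ outside it are related as well, so the junk values
  outside the cube do not affect the set of classes.\<close>
definition cube_homotopy ::
    "nat \<Rightarrow> 'a topology \<Rightarrow> 'a \<Rightarrow> (((nat \<Rightarrow> real) \<Rightarrow> 'a) \<times> ((nat \<Rightarrow> real) \<Rightarrow> 'a)) set" where
  "cube_homotopy k X x = {(f, g). homotopic_with (based_map k x) (cube k) X f g}"

definition cube_concat ::
    "((nat \<Rightarrow> real) \<Rightarrow> 'a) \<Rightarrow> ((nat \<Rightarrow> real) \<Rightarrow> 'a) \<Rightarrow> (nat \<Rightarrow> real) \<Rightarrow> 'a" where
  "cube_concat f g t = (if t 0 \<le> 1 / 2 then f (t(0 := 2 * t 0)) else g (t(0 := 2 * t 0 - 1)))"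

text \<open>Meaningful for \<open>k \<ge> 1\<close> and \<open>x \<in> topspace X\<close>. The union in the product is
  the usual way of lifting an operation to a quotient: it is the single class of
  \<open>cube_concat f g\<close>, for any representatives \<open>f\<close> and \<open>g\<close>.\<close>
definition homotopy_group :: "nat \<Rightarrow> 'a topology \<Rightarrow> 'a \<Rightarrow> ((nat \<Rightarrow> real) \<Rightarrow> 'a) set monoid" where
  "homotopy_group k X x =
    \<lparr>carrier = cube_maps k X x // cube_homotopy k X x,
     mult = (\<lambda>A B. \<Union>f\<in>A. \<Union>g\<in>B. cube_homotopy k X x `` {cube_concat f g}),
     one = cube_homotopy k X x `` {\<lambda>_. x}\<rparr>"

definition hermitian :: "complex^'n^'n \<Rightarrow> bool" where
  "hermitian A \<longleftrightarrow> (\<forall>i j. A $ i $ j = cnj (A $ j $ i))"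

definition charpoly :: "complex^'n^'n \<Rightarrow> complex poly" where
  "charpoly A = det (mat [:0, 1:] - map_matrix (\<lambda>c. [:c:]) A)"

text \<open>Algebraic multiplicities; \<open>Polynomial.order\<close> is qualified because of the order of a group.\<close>
definition eigenvalue_mult :: "complex^'n^'n \<Rightarrow> complex \<Rightarrow> nat" where
  "eigenvalue_mult A z = Polynomial.order z (charpoly A)"

definition real_eigenvalues :: "complex^'n^'n \<Rightarrow> real set" where
  "real_eigenvalues A = {x. \<exists>v. v \<noteq> 0 \<and> A *v v = complex_of_real x *s v}"

definition signature :: "complex^'n^'n \<Rightarrow> int" where
  "signature A =
    (\<Sum>x \<in> {x \<in> real_eigenvalues A. x > 0}. int (eigenvalue_mult A (complex_of_real x))) -
    (\<Sum>x \<in> {x \<in> real_eigenvalues A. x < 0}. int (eigenvalue_mult A (complex_of_real x)))"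

definition toeplitz_herm_inv :: "(complex^2^2) set" where
  "toeplitz_herm_inv = {A. invertible A \<and>
    (\<exists>a0 a1 a2 :: real.
      A = vector [vector [complex_of_real a0, complex_of_real a1 + \<i> * complex_of_real a2],
                  vector [complex_of_real a1 - \<i> * complex_of_real a2, complex_of_real a0]])}"

definition herm_inv :: "(complex^2^2) set" where
  "herm_inv = {A. invertible A \<and> hermitian A}"

end

theory Submission
  imports Defs "HOL-Complex_Analysis.Riemann_Mapping"
begin

text \<open>Writing a hermitian matrix as \<open>a I + B\<close> with \<open>B\<close> traceless, its eigenvalues are \<open>a \<plusminus> \<bar>v\<bar>\<close>, where \<open>v\<close> is
  the coordinate vector of \<open>B\<close> in \<open>\<complex> \<times> \<real>\<close> (in \<open>\<complex>\<close> for a Toeplitz matrix). So the invertible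
  matrices are the points off the light cone \<open>\<bar>a\<bar> = \<bar>v\<bar>\<close>; the definite ones form two convex cones, and
  those of signature \<open>0\<close> form the region \<open>\<bar>a\<bar> < \<bar>v\<bar>\<close>, which deforms onto the punctured space of all
  \<open>v \<noteq> 0\<close>, hence onto a circle or a 2-sphere.

  The punctured plane is handled by winding numbers and by logarithms of maps on cubes. For the second
  homotopy group of the sphere, a based map of the square is lifted through the Hopf map by discrete
  parallel transport: points are projected successively onto nearby complex lines. The lift is
  constant on three sides of the square, and its phase along the fourth side is a loop in the punctured
  plane; its winding number is the degree. That maps with equal degree are homotopic, and that
  every degree occurs, follows by extending maps from the boundaries of the 3-cube and of the square to
  their interiors, with values in the 3-sphere.\<close>

section \<open>Maps of cubes and their degrees\<close>

text \<open>Two obstacles shape the proof. The groups are quotients of sets of maps with a fixed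
  base point. All comparisons of spaces are therefore made on representatives, by
  \<open>classified_by_degree\<close> and \<open>all_null_homotopic\<close>, and every deformation
  fixes the given point, so that base points never have to be changed. The Hopf map, in turn, has no
  section over the whole sphere, so a lift has to be carried along segments. Neighbouring points of
  the sphere are not antipodal, hence their complex lines are not orthogonal and projecting a
  nonzero vector from one line to the next never gives 0. Projections shrink vectors, but the Hopf
  map ignores nonzero scalars, so any nonvanishing vectors of
  \<open>complex \<times> complex\<close> are accepted as lifts. All ambiguity of a lift is then a
  scalar factor, and what separates two maps of the square is a single loop of scalars.\<close>

lemma topspace_cube: "topspace (cube k) = (\<Pi>\<^sub>E i\<in>{..<k}. {0..1})"
  by (simp add: cube_def)

lemma cube_boundary_subset: "cube_boundary k \<subseteq> topspace (cube k)"
  by (auto simp: cube_boundary_def)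

lemma cube_boundary_nonempty:
  assumes "k \<ge> 1"
  shows "(\<lambda>i\<in>{..<k}. 0) \<in> cube_boundary k"
  using assms by (auto simp: cube_boundary_def topspace_cube intro!: exI[of _ 0])

lemma connected_space_cube: "connected_space (cube k)"
  by (simp add: cube_def connected_space_product_topology connected_space_subtopology)

lemma continuous_map_into_cube:
  "continuous_map X (cube k) f \<longleftrightarrow>
    (\<forall>x\<in>topspace X. f x \<in> extensional {..<k}) \<and>
    (\<forall>i<k. continuous_map X euclideanreal (\<lambda>x. f x i) \<and> (\<forall>x\<in>topspace X. 0 \<le> f x i \<and> f x i \<le> 1))"
  by (simp add: cube_def continuous_map_componentwise continuous_map_in_subtopology image_subset_iff
      Pi_iff Ball_def)

lemma continuous_map_cube_coordinate:
  assumes "i < k"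
  shows "continuous_map (cube k) euclideanreal (\<lambda>t. t i)"
  using continuous_map_into_cube[of "cube k" k id] assms by (auto simp: id_def)

lemma based_map_cong:
  assumes "\<And>t. t \<in> topspace (cube k) \<Longrightarrow> f t = g t"
  shows "based_map k x f \<longleftrightarrow> based_map k x g"
  using assms cube_boundary_subset[of k] unfolding based_map_def by (metis subsetD)

lemma homotopic_based_refl:
  "homotopic_with (based_map k x) (cube k) X f f \<longleftrightarrow> f \<in> cube_maps k X x"
  by (simp add: cube_maps_def)

lemma homotopic_based_imp_cube_maps:
  assumes "homotopic_with (based_map k x) (cube k) X f g"
  shows "f \<in> cube_maps k X x" "g \<in> cube_maps k X x"
  using homotopic_with_imp_continuous_maps[OF assms] homotopic_with_imp_property[OF assms]
  by (auto simp: cube_maps_def)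

lemma homotopic_based_iff:
  "homotopic_with (based_map k x) (cube k) X f g \<longleftrightarrow>
    (\<exists>h. continuous_map (prod_topology (top_of_set {0..1::real}) (cube k)) X h \<and>
      (\<forall>t\<in>topspace (cube k). h (0, t) = f t) \<and> (\<forall>t\<in>topspace (cube k). h (1, t) = g t) \<and>
      (\<forall>u\<in>{0..1}. \<forall>t\<in>cube_boundary k. h (u, t) = x))"
  by (subst homotopic_with, metis based_map_cong) (simp add: based_map_def)

lemma homotopic_based_cong:
  assumes "homotopic_with (based_map k x) (cube k) X f g"
    and "\<And>t. t \<in> topspace (cube k) \<Longrightarrow> f' t = f t" "\<And>t. t \<in> topspace (cube k) \<Longrightarrow> g' t = g t"
  shows "homotopic_with (based_map k x) (cube k) X f' g'"
  using assms(1) unfolding homotopic_based_iff by (simp add: assms(2,3))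

lemma const_in_cube_maps:
  assumes "x \<in> topspace X"
  shows "(\<lambda>_. x) \<in> cube_maps k X x"
  using assms by (simp add: cube_maps_def based_map_def)

lemma cube_concat_in_cube_maps:
  assumes k: "k \<ge> 1" and f: "f \<in> cube_maps k X x" and g: "g \<in> cube_maps k X x"
  shows "cube_concat f g \<in> cube_maps k X x"
proof -
  have cf: "continuous_map (cube k) X f" and cg: "continuous_map (cube k) X g"
    and bf: "\<And>t. t \<in> cube_boundary k \<Longrightarrow> f t = x" and bg: "\<And>t. t \<in> cube_boundary k \<Longrightarrow> g t = x"
    using f g by (auto simp: cube_maps_def based_map_def)
  have coord: "continuous_map (subtopology (cube k) S) euclideanreal (\<lambda>t. t i)" if "i < k" for i S
    by (intro continuous_map_from_subtopology continuous_map_cube_coordinate that)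
  \<comment> \<open>The cases \<open>c = 0\<close> and \<open>c = 1\<close> are the
    reparametrisations of the two halves.\<close>
  have upd: "continuous_map (subtopology (cube k) S) (cube k) (\<lambda>t. t(0 := 2 * t 0 - c))"
    if S: "\<And>t. t \<in> S \<Longrightarrow> t \<in> topspace (cube k) \<Longrightarrow> 0 \<le> 2 * t 0 - c \<and> 2 * t 0 - c \<le> 1" for S c
    unfolding continuous_map_into_cube
  proof (intro conjI ballI allI impI)
    fix i assume "i < k"
    then show "continuous_map (subtopology (cube k) S) euclideanreal (\<lambda>t. (t(0 := 2 * t 0 - c)) i)"
      using coord[of i S] coord[of 0 S] by (cases "i = 0") (auto intro!: continuous_intros)
  next
    fix t i assume t: "t \<in> topspace (subtopology (cube k) S)" and i: "i < k"
    show "0 \<le> (t(0 := 2 * t 0 - c)) i" "(t(0 := 2 * t 0 - c)) i \<le> 1"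
      using S[of t] t i by (auto simp: topspace_cube PiE_iff)
  qed (use k in \<open>auto simp: topspace_cube PiE_iff extensional_def\<close>)
  \<comment> \<open>At \<open>t 0 = 1 / 2\<close> the two branches evaluate \<open>f\<close> and
    \<open>g\<close> on opposite faces; both values are \<open>x\<close>, so the pieces fit
    together.\<close>
  have mid: "t(0 := c) \<in> cube_boundary k" if "t \<in> topspace (cube k)" "c = 0 \<or> c = 1" for t c
    using that k by (auto simp: cube_boundary_def topspace_cube PiE_iff extensional_def intro!: exI[of _ 0])
  have "continuous_map (cube k) X
      (\<lambda>t. if t 0 \<le> 1 / 2 then f (t(0 := 2 * t 0)) else g (t(0 := 2 * t 0 - 1)))"
  proof (rule continuous_map_cases_le)
    show "continuous_map (cube k) euclideanreal (\<lambda>t. t 0)"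
      using k by (intro continuous_map_cube_coordinate) simp
    show "continuous_map (subtopology (cube k) {t \<in> topspace (cube k). t 0 \<le> 1 / 2}) X
        (\<lambda>t. f (t(0 := 2 * t 0)))"
      using continuous_map_compose[OF upd[of "{t \<in> topspace (cube k). t 0 \<le> 1 / 2}" 0] cf] k
      by (auto simp: o_def topspace_cube PiE_iff)
    show "continuous_map (subtopology (cube k) {t \<in> topspace (cube k). 1 / 2 \<le> t 0}) X
        (\<lambda>t. g (t(0 := 2 * t 0 - 1)))"
      using continuous_map_compose[OF upd[of "{t \<in> topspace (cube k). 1 / 2 \<le> t 0}" 1] cg] k
      by (auto simp: o_def topspace_cube PiE_iff)
  qed (use mid bf bg in auto)
  moreover have "cube_concat f g t = x" if bd: "t \<in> cube_boundary k" for t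
  proof -
    have t: "t \<in> topspace (cube k)" using that cube_boundary_subset by blast
    obtain i where i: "i < k" "t i = 0 \<or> t i = 1" using bd unfolding cube_boundary_def by blast
    have 1: "t(0 := 2 * t 0) \<in> cube_boundary k" if "t 0 \<le> 1/2"
    proof (cases "i = 0")
      case True
      then show ?thesis using i that mid[OF t] by auto
    next
      case False
      then show ?thesis using t that i k
        by (auto simp: cube_boundary_def topspace_cube PiE_iff extensional_def intro!: exI[of _ i])
    qed
    have 2: "t(0 := 2 * t 0 - 1) \<in> cube_boundary k" if "t 0 > 1/2"
    proof (cases "i = 0")
      case True
      then show ?thesis using i that mid[OF t, of 1] by auto
    next
      case False
      then show ?thesis using t that i k
        by (auto simp: cube_boundary_def topspace_cube PiE_iff extensional_def intro!: exI[of _ i])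
    qed
    show ?thesis using 1 2 bf bg by (auto simp: cube_concat_def)
  qed
  ultimately show ?thesis
    by (simp add: cube_maps_def based_map_def cube_concat_def[abs_def])
qed

lemma comp_cube_concat: "r \<circ> cube_concat f g = cube_concat (r \<circ> f) (r \<circ> g)"
  by (auto simp: cube_concat_def)

text \<open>An isomorphism with the integers, phrased for representatives: a complete, additive and
  surjective invariant. In this form it passes along retractions and clopen inclusions without
  touching the quotient.\<close>

definition classified_by_degree :: "nat \<Rightarrow> 'a topology \<Rightarrow> 'a \<Rightarrow> bool" where
  "classified_by_degree k X x \<longleftrightarrow> (\<exists>deg :: ((nat \<Rightarrow> real) \<Rightarrow> 'a) \<Rightarrow> int.
    (\<forall>f\<in>cube_maps k X x. \<forall>g\<in>cube_maps k X x.
      (homotopic_with (based_map k x) (cube k) X f g \<longleftrightarrow> deg f = deg g) \<and>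
      deg (cube_concat f g) = deg f + deg g) \<and>
    (\<forall>n. \<exists>f\<in>cube_maps k X x. deg f = n))"

definition all_null_homotopic :: "nat \<Rightarrow> 'a topology \<Rightarrow> 'a \<Rightarrow> bool" where
  "all_null_homotopic k X x \<longleftrightarrow>
    (\<forall>f\<in>cube_maps k X x. homotopic_with (based_map k x) (cube k) X f (\<lambda>_. x))"

lemma homotopy_group_iso_integer_group:
  assumes k: "k \<ge> 1" and "classified_by_degree k X x"
  shows "homotopy_group k X x \<cong> integer_group"
proof -
  let ?M = "cube_maps k X x" and ?R = "cube_homotopy k X x" and ?G = "homotopy_group k X x"
  obtain deg :: "((nat \<Rightarrow> real) \<Rightarrow> 'a) \<Rightarrow> int" where
    deg: "\<And>f g. f \<in> ?M \<Longrightarrow> g \<in> ?M \<Longrightarrow>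
        homotopic_with (based_map k x) (cube k) X f g \<longleftrightarrow> deg f = deg g"
    and add: "\<And>f g. f \<in> ?M \<Longrightarrow> g \<in> ?M \<Longrightarrow> deg (cube_concat f g) = deg f + deg g"
    and surj: "\<And>n. \<exists>f\<in>?M. deg f = n"
    using assms unfolding classified_by_degree_def by metis
  have cls: "?R `` {f} = {g \<in> ?M. deg g = deg f}" if "f \<in> ?M" for f
  proof (rule Set.set_eqI)
    fix g
    show "g \<in> ?R `` {f} \<longleftrightarrow> g \<in> {g \<in> ?M. deg g = deg f}"
      using deg[OF that, of g] homotopic_based_imp_cube_maps(2)[of k x X f g]
      by (auto simp: cube_homotopy_def)
  qed
  \<comment> \<open>The homotopy classes are exactly the fibres of the degree, so the integers index
    the carrier.\<close>
  define C where "C n = {f \<in> ?M. deg f = n}" for n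
  have carr: "carrier ?G = range C"
  proof -
    have "carrier ?G = (\<lambda>f. C (deg f)) ` ?M"
      using cls by (auto simp: homotopy_group_def quotient_def C_def)
    also have "\<dots> = range C" using surj by (auto simp: image_iff) metis
    finally show ?thesis .
  qed
  have mult: "C m \<otimes>\<^bsub>?G\<^esub> C n = C (m + n)" for m n
  proof -
    have "?R `` {cube_concat f g} = C (m + n)" if "f \<in> C m" "g \<in> C n" for f g
      using that cls[OF cube_concat_in_cube_maps[OF k, of f X x g]] add[of f g] by (auto simp: C_def)
    \<comment> \<open>The product is a union over representatives; it equals the common class only
      because both index sets are nonempty.\<close>
    moreover have "C m \<noteq> {}" "C n \<noteq> {}" using surj by (auto simp: C_def)
    ultimately show ?thesis by (simp add: homotopy_group_def cong: SUP_cong) 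
  qed
  have inj: "inj C"
  proof (rule injI)
    fix m n assume eq: "C m = C n"
    obtain f where "f \<in> C m" using surj[of m] by (auto simp: C_def)
    with eq show "m = n" by (auto simp: C_def)
  qed
  have "inv_into UNIV C \<in> iso ?G integer_group"
    unfolding iso_def hom_def using inj carr mult bij_betw_inv_into[of C UNIV "range C"]
    by (auto simp: inv_f_f bij_betw_def)
  then show ?thesis by (auto simp: is_iso_def)
qed

lemma trivial_homotopy_group:
  assumes k: "k \<ge> 1" and x: "x \<in> topspace X" and null: "all_null_homotopic k X x"
  shows "trivial_group (homotopy_group k X x)"
proof -
  let ?M = "cube_maps k X x" and ?R = "cube_homotopy k X x" and ?G = "homotopy_group k X x"
  have const: "homotopic_with (based_map k x) (cube k) X f (\<lambda>_. x)" if "f \<in> ?M" for f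
    using null that by (auto simp: all_null_homotopic_def)
  have hom: "homotopic_with (based_map k x) (cube k) X f g" if "f \<in> ?M" "g \<in> ?M" for f g
    using homotopic_with_trans[OF const[OF that(1)] homotopic_with_symD[OF const[OF that(2)]]] .
  have cls: "?R `` {f} = ?M" if "f \<in> ?M" for f
  proof (rule Set.set_eqI)
    fix g
    show "g \<in> ?R `` {f} \<longleftrightarrow> g \<in> ?M"
      using hom[OF that, of g] homotopic_based_imp_cube_maps(2)[of k x X f g]
      by (auto simp: cube_homotopy_def)
  qed
  have ne: "(\<lambda>_. x) \<in> ?M" by (rule const_in_cube_maps[OF x])
  have carr: "carrier ?G = {?M}"
    using cls ne by (auto simp: homotopy_group_def quotient_def)
  have one: "\<one>\<^bsub>?G\<^esub> = ?M" using cls[OF ne] by (simp add: homotopy_group_def)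
  have "?R `` {cube_concat f g} = ?M" if "f \<in> ?M" "g \<in> ?M" for f g
    using cls cube_concat_in_cube_maps[OF k that] by blast
  then have mult: "?M \<otimes>\<^bsub>?G\<^esub> ?M = ?M"
    using ne by (auto simp: homotopy_group_def)
  have "group ?G"
    by (rule groupI) (simp_all add: carr one mult)
  then show ?thesis by (simp add: trivial_group_def carr one)
qed

section \<open>Invariance under deformations that fix the base point\<close>

lemma cube_maps_compose:
  assumes "f \<in> cube_maps k X x" "continuous_map X Y r"
  shows "r \<circ> f \<in> cube_maps k Y (r x)"
  using assms by (auto simp: cube_maps_def based_map_def intro: continuous_map_compose)

lemma homotopic_based_compose:
  assumes "homotopic_with (based_map k x) (cube k) X f g" "continuous_map X Y r"
  shows "homotopic_with (based_map k (r x)) (cube k) Y (r \<circ> f) (r \<circ> g)"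
  by (rule homotopic_with_compose_continuous_map_left[OF assms]) (auto simp: based_map_def)

text \<open>\<open>X\<close> deforms onto a copy of \<open>Y\<close> while \<open>x\<close> stays fixed. The embedding \<open>j\<close> of that copy
  may depend on \<open>x\<close>; it has to pass through \<open>x\<close>.\<close>
locale based_retract =
  fixes X :: "'a topology" and Y :: "'b topology" and x r j
  assumes cont_r: "continuous_map X Y r" and cont_j: "continuous_map Y X j"
    and base: "x \<in> topspace X" "j (r x) = x"
    and retraction: "\<And>y. y \<in> topspace Y \<Longrightarrow> r (j y) = y"
    and deformation: "homotopic_with (\<lambda>h. h x = x) X X id (j \<circ> r)"
begin

lemma deform_cube_map:
  assumes f: "f \<in> cube_maps k X x"
  shows "homotopic_with (based_map k x) (cube k) X f (j \<circ> (r \<circ> f))"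
proof -
  have "homotopic_with (based_map k x) (cube k) X (id \<circ> f) ((j \<circ> r) \<circ> f)"
    by (rule homotopic_with_compose_continuous_map_right[OF deformation])
      (use f in \<open>auto simp: cube_maps_def based_map_def\<close>)
  then show ?thesis by (simp add: o_assoc)
qed

text \<open>For the converse, \<open>j\<close> carries the homotopy back into \<open>X\<close>, and
  the deformation connects its ends with \<open>f\<close> and \<open>g\<close>.\<close>

lemma homotopic_iff:
  assumes f: "f \<in> cube_maps k X x" and g: "g \<in> cube_maps k X x"
  shows "homotopic_with (based_map k x) (cube k) X f g \<longleftrightarrow>
    homotopic_with (based_map k (r x)) (cube k) Y (r \<circ> f) (r \<circ> g)"
proof
  assume "homotopic_with (based_map k (r x)) (cube k) Y (r \<circ> f) (r \<circ> g)"
  from homotopic_based_compose[OF this cont_j]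
  have "homotopic_with (based_map k x) (cube k) X (j \<circ> (r \<circ> f)) (j \<circ> (r \<circ> g))"
    by (simp add: base)
  then show "homotopic_with (based_map k x) (cube k) X f g"
    by (meson deform_cube_map[OF f] deform_cube_map[OF g] homotopic_with_trans homotopic_with_symD)
qed (rule homotopic_based_compose[OF _ cont_r])

lemma classified_by_degree:
  assumes "classified_by_degree k Y (r x)"
  shows "classified_by_degree k X x"
proof -
  let ?M = "cube_maps k Y (r x)"
  obtain deg :: "((nat \<Rightarrow> real) \<Rightarrow> 'b) \<Rightarrow> int" where
    deg: "\<And>f g. f \<in> ?M \<Longrightarrow> g \<in> ?M \<Longrightarrow>
        homotopic_with (based_map k (r x)) (cube k) Y f g \<longleftrightarrow> deg f = deg g"
    and add: "\<And>f g. f \<in> ?M \<Longrightarrow> g \<in> ?M \<Longrightarrow> deg (cube_concat f g) = deg f + deg g"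
    and surj: "\<And>n. \<exists>f\<in>?M. deg f = n"
    using assms unfolding classified_by_degree_def by metis
  have rf: "r \<circ> f \<in> ?M" if "f \<in> cube_maps k X x" for f
    using that cont_r by (rule cube_maps_compose)
  have "\<exists>f\<in>cube_maps k X x. deg (r \<circ> f) = n" for n
  proof -
    obtain f where f: "f \<in> ?M" "deg f = n" using surj by blast
    have jf: "j \<circ> f \<in> cube_maps k X x" using cube_maps_compose[OF f(1) cont_j] by (simp add: base)
    \<comment> \<open>\<open>r\<close> inverts \<open>j\<close> only on \<open>topspace Y\<close>,
      so the two maps agree on the cube but perhaps not elsewhere; a constant homotopy still relates
      them.\<close>
    have "homotopic_with (based_map k (r x)) (cube k) Y (r \<circ> (j \<circ> f)) f"
      by (rule homotopic_based_cong[where f = f and g = f])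
        (use f(1) retraction in \<open>auto simp: homotopic_based_refl cube_maps_def continuous_map_def\<close>)
    then have "deg (r \<circ> (j \<circ> f)) = n" using deg rf[OF jf] f by auto
    then show ?thesis using jf by blast
  qed
  then show ?thesis
    unfolding classified_by_degree_def
    by (intro exI[of _ "\<lambda>f. deg (r \<circ> f)"]) (auto simp: homotopic_iff deg rf comp_cube_concat add)
qed

lemma all_null_homotopic:
  assumes "all_null_homotopic k Y (r x)"
  shows "all_null_homotopic k X x"
  unfolding all_null_homotopic_def
proof
  fix f assume f: "f \<in> cube_maps k X x"
  have "r \<circ> f \<in> cube_maps k Y (r x)" using f cont_r by (rule cube_maps_compose)
  then have "homotopic_with (based_map k (r x)) (cube k) Y (r \<circ> f) (\<lambda>_. r x)"
    using assms by (simp add: all_null_homotopic_def)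
  then show "homotopic_with (based_map k x) (cube k) X f (\<lambda>_. x)"
    using homotopic_iff[OF f const_in_cube_maps[OF base(1)]] by (simp add: o_def)
qed

end

section \<open>Restriction to a clopen part of the target\<close>

lemma image_in_component:
  assumes conn: "connected_space Z" and h: "continuous_map Z (top_of_set S) h"
    and clopen: "openin (top_of_set S) T" "closedin (top_of_set S) T"
    and z: "z \<in> topspace Z" "h z \<in> T"
  shows "h ` topspace Z \<subseteq> T"
proof -
  have "connectedin (top_of_set S) (h ` topspace Z)"
    using connectedin_continuous_map_image[OF h] conn by (simp add: connectedin_topspace)
  then show ?thesis
    using connectedin_clopen_cases[OF _ clopen(2,1)] z by (fastforce simp: disjnt_iff)
qed

lemma continuous_map_into_component:
  assumes "connected_space Z" "openin (top_of_set S) T" "closedin (top_of_set S) T"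
    and "z \<in> topspace Z" "h z \<in> T"
  shows "continuous_map Z (top_of_set S) h \<longleftrightarrow> continuous_map Z (top_of_set T) h"
  using image_in_component[of Z S h T z] assms openin_imp_subset[OF assms(2)]
  unfolding continuous_map_in_subtopology by blast

text \<open>The cube and the cylinder over it are connected, and for \<open>k \<ge> 1\<close> the
  corner \<open>?c\<close> lies on the boundary and is sent to \<open>x\<close>. Based maps and
  based homotopies into \<open>S\<close> therefore cannot leave \<open>T\<close>.\<close>

lemma component_cube_maps:
  fixes S T :: "'a::topological_space set"
  assumes k: "k \<ge> 1" and x: "x \<in> T"
    and clopen: "openin (top_of_set S) T" "closedin (top_of_set S) T"
  shows cube_maps_component: "cube_maps k (top_of_set S) x = cube_maps k (top_of_set T) x"
    and homotopic_based_component: "homotopic_with (based_map k x) (cube k) (top_of_set S) f g \<longleftrightarrow>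
      homotopic_with (based_map k x) (cube k) (top_of_set T) f g"
proof -
  let ?c = "(\<lambda>i\<in>{..<k}. 0) :: nat \<Rightarrow> real"
  note c = cube_boundary_nonempty[OF k]
  note c' = subsetD[OF cube_boundary_subset c]
  show "cube_maps k (top_of_set S) x = cube_maps k (top_of_set T) x"
    using continuous_map_into_component[OF connected_space_cube clopen c'] c x
    by (auto simp: cube_maps_def based_map_def)
  let ?Z = "prod_topology (top_of_set {0..1::real}) (cube k)"
  have conn: "connected_space ?Z"
    by (simp add: connected_space_prod_topology connected_space_cube connected_space_subtopology)
  have "(continuous_map ?Z (top_of_set S) h \<and> (\<forall>u\<in>{0..1}. \<forall>t\<in>cube_boundary k. h (u, t) = x)) \<longleftrightarrow>
    (continuous_map ?Z (top_of_set T) h \<and> (\<forall>u\<in>{0..1}. \<forall>t\<in>cube_boundary k. h (u, t) = x))" for h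
    using continuous_map_into_component[OF conn clopen, of "(0, ?c)" h] c c' x by auto
  then show "homotopic_with (based_map k x) (cube k) (top_of_set S) f g \<longleftrightarrow>
      homotopic_with (based_map k x) (cube k) (top_of_set T) f g"
    unfolding homotopic_based_iff by blast
qed

lemma classified_by_degree_component:
  fixes S T :: "'a::topological_space set"
  assumes "k \<ge> 1" "x \<in> T" "openin (top_of_set S) T" "closedin (top_of_set S) T"
    and "classified_by_degree k (top_of_set T) x"
  shows "classified_by_degree k (top_of_set S) x"
  using assms(5) unfolding classified_by_degree_def component_cube_maps[OF assms(1-4)] .

lemma all_null_homotopic_component:
  fixes S T :: "'a::topological_space set"
  assumes "k \<ge> 1" "x \<in> T" "openin (top_of_set S) T" "closedin (top_of_set S) T"
    and "all_null_homotopic k (top_of_set T) x"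
  shows "all_null_homotopic k (top_of_set S) x"
  using assms(5) unfolding all_null_homotopic_def component_cube_maps[OF assms(1-4)] .

section \<open>The light cone in a normed space\<close>

lemma homotopic_with_linear_based:
  fixes f g :: "'a::real_normed_vector \<Rightarrow> 'a"
  assumes "continuous_on S f" "continuous_on S g"
    and "\<And>y. y \<in> S \<Longrightarrow> closed_segment (f y) (g y) \<subseteq> T"
    and "f x = x" "g x = x"
  shows "homotopic_with (\<lambda>h. h x = x) (top_of_set S) (top_of_set T) f g"
  unfolding homotopic_with_def
proof (intro exI conjI ballI allI)
  let ?h = "\<lambda>p. (1 - fst p) *\<^sub>R f (snd p) + fst p *\<^sub>R g (snd p) :: 'a"
  have "continuous_on ({0..1} \<times> S) ?h"
    by (intro continuous_intros continuous_on_compose2[OF assms(1)] continuous_on_compose2[OF assms(2)])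
      auto
  moreover have "?h \<in> {0..1} \<times> S \<rightarrow> T"
    using assms(3) by (fastforce simp: closed_segment_def)
  ultimately show "continuous_map (prod_topology (top_of_set {0..1}) (top_of_set S)) (top_of_set T) ?h"
    by (simp add: prod_topology_subtopology_eu)
qed (use assms in \<open>auto simp: algebra_simps\<close>)

lemma all_null_homotopic_convex:
  fixes S :: "'a::real_normed_vector set"
  assumes S: "convex S" and x: "x \<in> S"
  shows "all_null_homotopic k (top_of_set S) x"
proof -
  interpret based_retract "top_of_set S" "top_of_set {x}" x "\<lambda>_. x" "\<lambda>_. x"
  proof
    show "homotopic_with (\<lambda>h. h x = x) (top_of_set S) (top_of_set S) id ((\<lambda>_. x) \<circ> (\<lambda>_. x))"
      using S x by (intro homotopic_with_linear_based) (auto simp: closed_segment_subset id_def)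
  qed (use x in auto)
  have "all_null_homotopic k (top_of_set {x}) x"
    unfolding all_null_homotopic_def
  proof
    fix f assume f: "f \<in> cube_maps k (top_of_set {x}) x"
    show "homotopic_with (based_map k x) (cube k) (top_of_set {x}) f (\<lambda>_. x)"
      by (rule homotopic_based_cong[where f = f and g = f])
        (use f in \<open>auto simp: homotopic_based_refl cube_maps_def continuous_map_in_subtopology\<close>)
  qed
  then show ?thesis by (rule all_null_homotopic)
qed

definition spacelike :: "(real \<times> 'v::real_normed_vector) set" where
  "spacelike = {(a, v). \<bar>a\<bar> < norm v}"

definition lightlike :: "(real \<times> 'v::real_normed_vector) set" where
  "lightlike = {(a, v). \<bar>a\<bar> = norm v}"

text \<open>Off the light cone strict and weak inequalities coincide, so each region is cut out by
  an open and also by a closed condition. The sign \<open>e\<close> selects one of the two definite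
  cones.\<close>

lemma clopen_in_nonlightlike:
  fixes e :: real
  assumes "e \<in> {1, -1}"
  shows "openin (top_of_set (- lightlike)) (spacelike :: (real \<times> 'v::real_normed_vector) set)"
    and "closedin (top_of_set (- lightlike)) (spacelike :: (real \<times> 'v) set)"
    and "openin (top_of_set (- lightlike)) {(a, v::'v). norm v < e * a}"
    and "closedin (top_of_set (- lightlike)) {(a, v::'v). norm v < e * a}"
proof -
  have eq: "spacelike = - lightlike \<inter> {p. \<bar>fst p\<bar> < norm (snd p :: 'v)}"
    "spacelike = - lightlike \<inter> {p. \<bar>fst p\<bar> \<le> norm (snd p :: 'v)}"
    by (auto simp: spacelike_def lightlike_def)
  have "open {p. \<bar>fst p\<bar> < norm (snd p :: 'v)}" "closed {p. \<bar>fst p\<bar> \<le> norm (snd p :: 'v)}"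
    by (intro open_Collect_less closed_Collect_le continuous_intros)+
  with eq show "openin (top_of_set (- lightlike)) (spacelike :: (real \<times> 'v) set)"
    "closedin (top_of_set (- lightlike)) (spacelike :: (real \<times> 'v) set)"
    unfolding openin_open closedin_closed by blast+
  have eq: "{(a, v::'v). norm v < e * a} = - lightlike \<inter> {p. norm (snd p :: 'v) < e * fst p}"
    "{(a, v::'v). norm v < e * a} = - lightlike \<inter> {p. norm (snd p :: 'v) \<le> e * fst p}"
    using assms by (auto simp: lightlike_def) (smt (verit) norm_ge_zero)+
  have "open {p. norm (snd p :: 'v) < e * fst p}" "closed {p. norm (snd p :: 'v) \<le> e * fst p}"
    by (intro open_Collect_less closed_Collect_le continuous_intros)+
  with eq show "openin (top_of_set (- lightlike)) {(a, v::'v). norm v < e * a}"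
    "closedin (top_of_set (- lightlike)) {(a, v::'v). norm v < e * a}"
    unfolding openin_open closedin_closed by blast+
qed

lemma convex_timelike: "convex {(a, v::'v::real_normed_vector). norm v < e * a}"
proof (rule convexI)
  fix p q :: "real \<times> 'v" and s t :: real
  assume p: "p \<in> {(a, v). norm v < e * a}" and q: "q \<in> {(a, v). norm v < e * a}"
    and st: "0 \<le> s" "0 \<le> t" "s + t = 1"
  have "norm (s *\<^sub>R snd p + t *\<^sub>R snd q) \<le> s * norm (snd p) + t * norm (snd q)"
    using norm_triangle_ineq[of "s *\<^sub>R snd p" "t *\<^sub>R snd q"] st by simp
  also have "\<dots> < s * (e * fst p) + t * (e * fst q)"
  \<comment> \<open>The first summand supplies the strict inequality, unless \<open>s = 0\<close>;
    then \<open>t = 1\<close> and \<open>q\<close> supplies it.\<close>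
  proof (cases "s = 0")
    case False
    then show ?thesis using p q st
      by (intro add_less_le_mono mult_strict_left_mono mult_left_mono) auto
  qed (use q st in auto)
  also have "\<dots> = e * (s * fst p + t * fst q)" by (simp add: algebra_simps)
  finally show "s *\<^sub>R p + t *\<^sub>R q \<in> {(a, v). norm v < e * a}"
    by (auto simp: case_prod_beta)
qed

text \<open>The target copy is the graph of \<open>c\<close> times the norm, where \<open>c\<close>
  is the slope of \<open>x\<close>. With slope 0 the deformation would move \<open>x\<close>; with
  this slope \<open>x\<close> lies on the graph, and the graph is spacelike since the slope is less
  than 1 in absolute value.\<close>

lemma based_retract_spacelike:
  fixes x :: "real \<times> 'v::real_normed_vector"
  assumes x: "x \<in> spacelike"
  shows "based_retract (top_of_set spacelike) (top_of_set (- {0})) x snd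
    (\<lambda>v. (fst x / norm (snd x) * norm v, v))"
proof
  define c where "c = fst x / norm (snd x)"
  let ?j = "\<lambda>v::'v. (c * norm v, v)"
  have c: "\<bar>c\<bar> < 1" using x by (auto simp: c_def spacelike_def case_prod_beta divide_simps)
  have base: "?j (snd x) = x" using x by (auto simp: c_def spacelike_def prod_eq_iff)
  have j_in: "?j v \<in> spacelike" if "v \<noteq> 0" for v
  proof -
    have "\<bar>c\<bar> * norm v < 1 * norm v" using that c by (intro mult_strict_right_mono) auto
    then show ?thesis by (auto simp: spacelike_def abs_mult)
  qed
  show "continuous_map (top_of_set spacelike) (top_of_set (- {0})) (snd :: real \<times> 'v \<Rightarrow> 'v)"
    by (auto simp: spacelike_def continuous_map_in_subtopology intro!: continuous_intros)
  show "continuous_map (top_of_set (- {0})) (top_of_set spacelike)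
      (\<lambda>v::'v. (fst x / norm (snd x) * norm v, v))"
    using j_in unfolding c_def[symmetric]
    by (auto simp: continuous_map_in_subtopology intro!: continuous_intros)
  show "homotopic_with (\<lambda>h. h x = x) (top_of_set spacelike) (top_of_set spacelike) id
      ((\<lambda>v. (fst x / norm (snd x) * norm v, v)) \<circ> snd)"
    unfolding c_def[symmetric] o_def
  proof (intro homotopic_with_linear_based)
    fix y :: "real \<times> 'v" assume y: "y \<in> spacelike"
    then have "snd y \<noteq> 0" by (auto simp: spacelike_def)
    \<comment> \<open>The region is not convex as a whole, but its slice over a fixed second
      component is an interval, and the deformation moves only the first component.\<close>
    have conv: "convex {p. snd p = snd y \<and> \<bar>fst p\<bar> < norm (snd y)}"
    proof -
      have "{p. snd p = snd y \<and> \<bar>fst p\<bar> < norm (snd y)} = {-norm (snd y)<..<norm (snd y)} \<times> {snd y}"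
        by auto
      then show ?thesis by (simp add: convex_Times)
    qed
    have "closed_segment (id y) (?j (snd y)) \<subseteq> {p. snd p = snd y \<and> \<bar>fst p\<bar> < norm (snd y)}"
      using y j_in[OF \<open>snd y \<noteq> 0\<close>]
      by (intro closed_segment_subset conv) (auto simp: spacelike_def case_prod_beta)
    then show "closed_segment (id y) (?j (snd y)) \<subseteq> spacelike"
      by (auto simp: spacelike_def)
  qed (use base in \<open>auto intro!: continuous_intros\<close>)
  show "(fst x / norm (snd x) * norm (snd x), snd x) = x" using base by (simp add: c_def)
qed (use x in auto)

text \<open>The copy of the sphere has radius \<open>norm x\<close>, so that it contains
  \<open>x\<close>. Points move along their rays by positive factors and never reach 0.\<close>

lemma based_retract_sphere:
  fixes x :: "'v::real_normed_vector"
  assumes x: "x \<noteq> 0"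
  shows "based_retract (top_of_set (- {0})) (top_of_set (sphere 0 1)) x (\<lambda>v. v /\<^sub>R norm v)
    (\<lambda>w. norm x *\<^sub>R w)"
proof
  show "homotopic_with (\<lambda>h. h x = x) (top_of_set (- {0})) (top_of_set (- {0})) id
      ((\<lambda>w. norm x *\<^sub>R w) \<circ> (\<lambda>v. v /\<^sub>R norm v))"
    unfolding o_def
  proof (intro homotopic_with_linear_based)
    fix y :: 'v assume y: "y \<in> - {0}"
    show "closed_segment (id y) (norm x *\<^sub>R (y /\<^sub>R norm y)) \<subseteq> - {0}"
    proof
      fix z assume "z \<in> closed_segment (id y) (norm x *\<^sub>R (y /\<^sub>R norm y))"
      then obtain u where u: "0 \<le> u" "u \<le> 1" "z = (1 - u) *\<^sub>R y + u *\<^sub>R (norm x *\<^sub>R (y /\<^sub>R norm y))"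
        by (auto simp: closed_segment_def)
      then have z: "z = ((1 - u) + u * (norm x / norm y)) *\<^sub>R y" 
        by (simp add: scaleR_add_left divide_inverse)
      have "norm x / norm y > 0" using x y by auto
      then have "(1 - u) + u * (norm x / norm y) > 0" using u
        by (cases "u = 1") (auto intro!: add_pos_nonneg)
      then show "z \<in> - {0}" using y z by auto
    qed
  qed (use x in \<open>auto intro!: continuous_intros simp: id_def\<close>)
qed (use x in \<open>auto simp: continuous_map_in_subtopology intro!: continuous_intros\<close>)

section \<open>Loops\<close>

definition line_to_cube :: "real \<Rightarrow> nat \<Rightarrow> real" where
  "line_to_cube s = (\<lambda>i\<in>{..<1}. s)"

lemma line_to_cube_in [simp]: "s \<in> {0..1} \<Longrightarrow> line_to_cube s \<in> topspace (cube 1)"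
  by (auto simp: line_to_cube_def topspace_cube)

lemma line_to_cube_0 [simp]: "line_to_cube s 0 = s"
  by (simp add: line_to_cube_def)

lemma line_to_cube_coordinate: "t \<in> topspace (cube 1) \<Longrightarrow> line_to_cube (t 0) = t"
  by (auto simp: line_to_cube_def topspace_cube PiE_iff extensional_def)

lemma line_to_cube_boundary: "cube_boundary 1 = {line_to_cube 0, line_to_cube 1}"
proof
  show "cube_boundary 1 \<subseteq> {line_to_cube 0, line_to_cube 1}"
    using line_to_cube_coordinate by (force simp: cube_boundary_def)
  show "{line_to_cube 0, line_to_cube 1} \<subseteq> cube_boundary 1"
    using line_to_cube_in[of 0] line_to_cube_in[of 1]
    by (auto simp: cube_boundary_def simp del: One_nat_def)
qed

lemma continuous_map_line_to_cube: "continuous_map (top_of_set {0..1}) (cube 1) line_to_cube"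
  by (auto simp: continuous_map_into_cube line_to_cube_def)

lemma continuous_map_coordinate_line: "continuous_map (cube 1) (top_of_set {0..1}) (\<lambda>t. t 0)"
  using continuous_map_cube_coordinate[of 0 1]
  by (auto simp: continuous_map_in_subtopology topspace_cube)

lemma cube_maps_loop:
  assumes "f \<in> cube_maps 1 (top_of_set S) x"
  shows "path (f \<circ> line_to_cube)" "path_image (f \<circ> line_to_cube) \<subseteq> S"
    "pathstart (f \<circ> line_to_cube) = x" "pathfinish (f \<circ> line_to_cube) = x"
proof -
  have "continuous_map (top_of_set {0..1}) (top_of_set S) (f \<circ> line_to_cube)"
    using assms continuous_map_compose[OF continuous_map_line_to_cube]
    unfolding cube_maps_def by blast
  then show "path (f \<circ> line_to_cube)" "path_image (f \<circ> line_to_cube) \<subseteq> S"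
    by (auto simp: path_def path_image_def)
  show "pathstart (f \<circ> line_to_cube) = x" "pathfinish (f \<circ> line_to_cube) = x"
    using assms unfolding cube_maps_def based_map_def line_to_cube_boundary
    by (auto simp: pathstart_def pathfinish_def)
qed

lemma loop_in_cube_maps:
  assumes "path p" "path_image p \<subseteq> S" "pathstart p = x" "pathfinish p = x"
  shows "p \<circ> (\<lambda>t. t 0) \<in> cube_maps 1 (top_of_set S) x"
proof -
  have "continuous_map (top_of_set {0..1}) (top_of_set S) p"
    using assms by (auto simp: path_def path_image_def)
  then have "continuous_map (cube 1) (top_of_set S) (p \<circ> (\<lambda>t. t 0))"
    by (rule continuous_map_compose[OF continuous_map_coordinate_line])
  then show ?thesis
    using assms unfolding cube_maps_def based_map_def line_to_cube_boundary
    by (auto simp: pathstart_def pathfinish_def)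
qed

lemma homotopic_based_1_iff:
  assumes f: "f \<in> cube_maps 1 (top_of_set S) x" and g: "g \<in> cube_maps 1 (top_of_set S) x"
  shows "homotopic_with (based_map 1 x) (cube 1) (top_of_set S) f g \<longleftrightarrow>
    homotopic_paths S (f \<circ> line_to_cube) (g \<circ> line_to_cube)"
proof
  assume "homotopic_with (based_map 1 x) (cube 1) (top_of_set S) f g"
  then show "homotopic_paths S (f \<circ> line_to_cube) (g \<circ> line_to_cube)"
    unfolding homotopic_paths_def cube_maps_loop[OF f]
    by (rule homotopic_with_compose_continuous_map_right[OF _ continuous_map_line_to_cube])
      (auto simp: based_map_def line_to_cube_boundary pathstart_def pathfinish_def simp del: One_nat_def)
next
  assume "homotopic_paths S (f \<circ> line_to_cube) (g \<circ> line_to_cube)"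
  then have "homotopic_with (based_map 1 x) (cube 1) (top_of_set S)
      ((f \<circ> line_to_cube) \<circ> (\<lambda>t. t 0)) ((g \<circ> line_to_cube) \<circ> (\<lambda>t. t 0))"
    unfolding homotopic_paths_def cube_maps_loop[OF f]
    by (rule homotopic_with_compose_continuous_map_right[OF _ continuous_map_coordinate_line])
      (auto simp: based_map_def line_to_cube_boundary pathstart_def pathfinish_def simp del: One_nat_def)
  then show "homotopic_with (based_map 1 x) (cube 1) (top_of_set S) f g"
    by (rule homotopic_based_cong) (simp_all add: line_to_cube_coordinate)
qed

lemma cube_concat_line_to_cube:
  "cube_concat f g \<circ> line_to_cube = (f \<circ> line_to_cube) +++ (g \<circ> line_to_cube)"
proof -
  have upd: "(line_to_cube s)(0 := c) = line_to_cube c" for s c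
    by (auto simp: line_to_cube_def)
  show ?thesis by (rule ext) (simp add: cube_concat_def joinpaths_def upd)
qed

lemma all_null_homotopic_simply_connected:
  fixes S :: "'a::real_normed_vector set"
  assumes S: "simply_connected S" and x: "x \<in> S"
  shows "all_null_homotopic 1 (top_of_set S) x"
  unfolding all_null_homotopic_def
proof
  fix f assume f: "f \<in> cube_maps 1 (top_of_set S) x"
  have c: "(\<lambda>_. x) \<in> cube_maps 1 (top_of_set S) x" using x by (intro const_in_cube_maps) simp
  have "homotopic_paths S (f \<circ> line_to_cube) ((\<lambda>_. x) \<circ> line_to_cube)"
    by (intro simply_connected_eq_homotopic_paths[THEN iffD1, OF S, THEN conjunct2, rule_format] conjI)
      (simp_all only: cube_maps_loop[OF f] cube_maps_loop[OF c])
  then show "homotopic_with (based_map 1 x) (cube 1) (top_of_set S) f (\<lambda>_. x)"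
    using homotopic_based_1_iff[OF f c] by simp
qed

lemma winding_number_loop_exists:
  assumes z: "z \<noteq> 0"
  obtains p where "path p" "path_image p \<subseteq> - {0}" "pathstart p = z" "pathfinish p = z"
    "winding_number p 0 = of_int n"
proof
  \<comment> \<open>A displacement of n periods of \<open>exp\<close> becomes n turns around
    0.\<close>
  define q where "q = linepath (Ln z) (Ln z + of_int n * (2 * of_real pi * \<i>))"
  have e: "exp (Ln z + of_int n * (2 * of_real pi * \<i>)) = z"
    using exp_integer_2pi[of "of_int n"] z by (simp add: exp_add mult_ac)
  show "path (exp \<circ> q)" unfolding q_def
    by (intro path_continuous_image continuous_intros path_linepath)
  show "path_image (exp \<circ> q) \<subseteq> - {0}" by (auto simp: path_image_def)
  show "pathstart (exp \<circ> q) = z" "pathfinish (exp \<circ> q) = z"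
    using z e by (simp_all add: pathstart_compose pathfinish_compose q_def)
  show "winding_number (exp \<circ> q) 0 = of_int n"
    by (subst winding_number_compose_exp) (auto simp: q_def)
qed

lemma classified_by_degree_punctured_plane:
  fixes z :: complex
  assumes z: "z \<noteq> 0"
  shows "classified_by_degree 1 (top_of_set (- {0})) z"
proof -
  let ?M = "cube_maps 1 (top_of_set (- {0})) z"
  \<comment> \<open>The winding number of a loop is a complex number that happens to be an integer;
    the floor only changes its type.\<close>
  define deg where "deg f = \<lfloor>Re (winding_number (f \<circ> line_to_cube) 0)\<rfloor>" for f
  have deg: "winding_number (f \<circ> line_to_cube) 0 = of_int (deg f)" if "f \<in> ?M" for f
    using integer_winding_number[of "f \<circ> line_to_cube" 0] cube_maps_loop[OF that]
    by (auto simp: deg_def elim!: Ints_cases)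
  have "homotopic_with (based_map 1 z) (cube 1) (top_of_set (- {0})) f g \<longleftrightarrow> deg f = deg g"
    if "f \<in> ?M" "g \<in> ?M" for f g
    unfolding homotopic_based_1_iff[OF that]
    using winding_number_homotopic_paths_eq[of "f \<circ> line_to_cube" 0 "g \<circ> line_to_cube"]
      cube_maps_loop[OF that(1)] cube_maps_loop[OF that(2)] deg[OF that(1)] deg[OF that(2)]
    by auto
  moreover have "deg (cube_concat f g) = deg f + deg g" if "f \<in> ?M" "g \<in> ?M" for f g
  proof -
    have "winding_number (cube_concat f g \<circ> line_to_cube) 0 = of_int (deg f + deg g)"
      using winding_number_join[of "f \<circ> line_to_cube" 0 "g \<circ> line_to_cube"]
        cube_maps_loop[OF that(1)] cube_maps_loop[OF that(2)] deg[OF that(1)] deg[OF that(2)]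
      by (auto simp: cube_concat_line_to_cube)
    then show ?thesis by (simp add: deg_def[of "cube_concat f g"])
  qed
  moreover have "\<exists>f\<in>?M. deg f = n" for n
  proof -
    obtain p where p: "path p" "path_image p \<subseteq> - {0}" "pathstart p = z" "pathfinish p = z"
      "winding_number p 0 = of_int n"
      by (rule winding_number_loop_exists[OF z])
    have "deg (p \<circ> (\<lambda>t. t 0)) = n" using p by (simp add: deg_def o_def)
    then show ?thesis using loop_in_cube_maps[OF p(1-4)] by blast
  qed
  ultimately show ?thesis unfolding classified_by_degree_def by blast
qed

section \<open>Logarithmic lifts\<close>

lemma mult_in_unit_interval: "a \<in> {0..1} \<Longrightarrow> b \<in> {0..1} \<Longrightarrow> a * b \<in> {0..1::real}"
  by (auto intro: mult_le_one)

text \<open>The sample points \<open>i / N * s\<close> scale with the endpoint \<open>s\<close>.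
  Lifts built from them are single formulas, continuous in \<open>s\<close>, and no gluing over
  subintervals is required.\<close>

lemma uniform_subdivision:
  fixes F :: "'a::metric_space \<times> real \<Rightarrow> 'b::metric_space"
  assumes K: "compact K" and F: "continuous_on (K \<times> {0..1}) F" and e: "e > 0"
  obtains N :: nat where "N > 0"
    "\<And>y s i. y \<in> K \<Longrightarrow> s \<in> {0..1} \<Longrightarrow> i < N \<Longrightarrow>
      dist (F (y, real (Suc i) / N * s)) (F (y, real i / N * s)) < e"
proof -
  have "uniformly_continuous_on (K \<times> {0..1}) F"
    by (intro compact_uniformly_continuous F compact_Times K compact_Icc)
  then obtain d where d: "d > 0"
    "\<And>p q. p \<in> K \<times> {0..1} \<Longrightarrow> q \<in> K \<times> {0..1} \<Longrightarrow> dist p q < d \<Longrightarrow> dist (F p) (F q) < e"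
    unfolding uniformly_continuous_on_def using e by metis
  obtain N :: nat where N: "N > 0" "1 / N < d"
    using reals_Archimedean2[of "1 / d"] d(1)
    by (metis divide_less_eq less_divide_eq mult.commute of_nat_0_less_iff zero_less_divide_1_iff
        order_less_trans zero_less_one)
  show ?thesis
  proof
    fix y s and i :: nat assume y: "y \<in> K" and s: "s \<in> {0..1::real}" and i: "i < N"
    have in01: "real m / N * s \<in> {0..1}" if "m \<le> N" for m
      using that N(1) s by (intro mult_in_unit_interval) auto
    have "dist (real (Suc i) / N * s) (real i / N * s) = s / N"
      using s by (simp add: dist_real_def add_divide_distrib distrib_right)
    also have "\<dots> \<le> 1 / N" using s by (simp add: divide_right_mono)
    finally have "dist (y, real (Suc i) / N * s) (y, real i / N * s) < d"
      using N by (simp add: dist_Pair_Pair)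
    then show "dist (F (y, real (Suc i) / N * s)) (F (y, real i / N * s)) < e"
      using in01[of i] in01[of "Suc i"] i y by (intro d(2)) auto
  qed (rule N)
qed

lemma continuous_on_rescale:
  fixes F :: "'a::metric_space \<times> real \<Rightarrow> 'b::metric_space"
  assumes F: "continuous_on (K \<times> {0..1}) F" and "c \<in> {0..1}"
  shows "continuous_on (K \<times> {0..1}) (\<lambda>p. F (fst p, c * snd p))"
  by (rule continuous_on_compose2[OF F])
    (use assms(2) in \<open>auto intro!: continuous_intros simp: mult_le_one\<close>)

text \<open>The value at \<open>(y, s)\<close> is \<open>z\<close> times a telescoping product of
  ratios of consecutive samples. The ratios lie so close to 1 that the principal logarithm is
  continuous there; the lift is the sum of these logarithms.\<close>

lemma continuous_log_lift:
  fixes F :: "'a::metric_space \<times> real \<Rightarrow> complex"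
  assumes K: "compact K" and F: "continuous_on (K \<times> {0..1}) F"
    and nz: "\<And>p. p \<in> K \<times> {0..1} \<Longrightarrow> F p \<noteq> 0" and z: "\<And>y. y \<in> K \<Longrightarrow> F (y, 0) = z"
  obtains L where "continuous_on (K \<times> {0..1}) L" "\<And>p. p \<in> K \<times> {0..1} \<Longrightarrow> exp (L p) = F p"
proof (cases "K = {}")
  case False
  \<comment> \<open>If consecutive values differ by less than the minimum modulus \<open>m\<close>,
    their ratio differs from 1 by less than 1, hence has positive real part.\<close>
  obtain m where m: "m > 0" "\<And>p. p \<in> K \<times> {0..1} \<Longrightarrow> m \<le> norm (F p)"
  proof -
    obtain p0 where p0: "p0 \<in> K \<times> {0..1}" "\<And>p. p \<in> K \<times> {0..1} \<Longrightarrow> norm (F p0) \<le> norm (F p)"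
      using continuous_attains_inf[of "K \<times> {0..1}" "\<lambda>p. norm (F p)"] False
        compact_Times[OF K compact_Icc[of 0 "1::real"]] continuous_on_norm[OF F]
      by (metis Times_empty atLeastAtMost_iff empty_iff order_refl zero_le_one)
    show ?thesis by (rule that[of "norm (F p0)"]) (use p0 nz in auto)
  qed
  obtain N :: nat where N: "N > 0"
    "\<And>y s i. y \<in> K \<Longrightarrow> s \<in> {0..1} \<Longrightarrow> i < N \<Longrightarrow>
      dist (F (y, real (Suc i) / N * s)) (F (y, real i / N * s)) < m"
    by (rule uniform_subdivision[OF K F m(1)]) auto
  define G where "G i p = F (fst p, real i / N * snd p)" for i p
  \<comment> \<open>All \<open>y\<close> share the starting value \<open>z\<close>, so the initial
    term is a constant and the branch cut of \<open>Ln\<close> at \<open>z\<close> does no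
    harm.\<close>
  define W where "W i p = Ln z + (\<Sum>j<i. Ln (G (Suc j) p / G j p))" for i p
  have in01: "real i / N * s \<in> {0..1}" if "i \<le> N" "s \<in> {0..1}" for i s
    using that N(1) by (intro mult_in_unit_interval) auto
  have Gnz: "G i p \<noteq> 0" "m \<le> norm (G i p)" if "i \<le> N" "p \<in> K \<times> {0..1}" for i p
    using nz[of "(fst p, real i / N * snd p)"] m(2)[of "(fst p, real i / N * snd p)"]
      in01[of i "snd p"] that by (auto simp: G_def mem_Times_iff)
  have contG: "continuous_on (K \<times> {0..1}) (G i)" if "i \<le> N" for i
    unfolding G_def using continuous_on_rescale[OF F, of "real i / N"] that N(1) by simp
  have ratio: "G (Suc j) p / G j p \<notin> \<real>\<^sub>\<le>\<^sub>0" if j: "j < N" and p: "p \<in> K \<times> {0..1}" for j p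
  proof -
    have "norm (G (Suc j) p - G j p) < m"
      using N(2)[of "fst p" "snd p" j] j p by (auto simp: G_def dist_norm mem_Times_iff)
    also have "m \<le> norm (G j p)" using Gnz(2)[of j p] j p by simp
    finally have "norm ((G (Suc j) p - G j p) / G j p) < 1"
      using Gnz(1)[of j p] j p by (simp add: norm_divide)
    then have "norm (G (Suc j) p / G j p - 1) < 1"
      using Gnz(1)[of j p] j p by (simp add: diff_divide_distrib)
    then have "Re (G (Suc j) p / G j p) > 0"
      using abs_Re_le_cmod[of "G (Suc j) p / G j p - 1"] by simp
    then show ?thesis by (simp add: complex_nonpos_Reals_iff)
  qed
  have "exp (W i p) = G i p" if "i \<le> N" "p \<in> K \<times> {0..1}" for i p
    using that(1)
  proof (induction i)
    case 0
    then show ?case using that(2) z nz[of "(fst p, 0)"] by (auto simp: W_def G_def)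
  next
    case (Suc i)
    have "exp (W (Suc i) p) = exp (W i p) * exp (Ln (G (Suc i) p / G i p))"
      by (simp add: W_def exp_add mult.assoc)
    then show ?case using Suc Gnz(1)[of i p] Gnz(1)[of "Suc i" p] that(2) by simp
  qed
  moreover have "continuous_on (K \<times> {0..1}) (W N)"
    unfolding W_def using ratio Gnz(1)
    by (intro continuous_intros contG) (auto simp: Suc_le_eq)
  moreover have "G N p = F p" for p using N(1) by (simp add: G_def)
  ultimately show ?thesis using that[of "W N"] by auto
qed (use that[of "\<lambda>_. 0"] in auto)

text \<open>The cube is an abstract product of topologies on extensional functions. Seen as a
  subspace of \<open>nat \<Rightarrow> real\<close> it gains \<open>continuous_on\<close>,
  \<open>compact\<close> and the metric that the lifting lemma asks for.\<close>

lemma cube_eq_top_of_set: "cube k = top_of_set (topspace (cube k))"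
proof -
  have "continuous_map (top_of_set (topspace (cube k))) (cube k) id"
    unfolding continuous_map_into_cube
  proof (intro conjI ballI allI impI)
    fix i
    show "continuous_map (top_of_set (topspace (cube k))) euclideanreal (\<lambda>t. id t i)"
      unfolding continuous_map_iff_continuous id_def
      by (rule continuous_on_product_then_coordinatewise[where f = "\<lambda>t. t", OF continuous_on_id])
  qed (auto simp: topspace_cube PiE_iff)
  moreover have "continuous_map (cube k) euclidean (\<lambda>t. t)"
    unfolding euclidean_product_topology[symmetric] continuous_map_componentwise_UNIV
  proof
    fix i show "continuous_map (cube k) euclideanreal (\<lambda>t. t i)"
    proof (cases "i < k")
      case False
      \<comment> \<open>Extensional functions have the fixed value \<open>undefined\<close> at such
        \<open>i\<close>, so the coordinate is constant on the cube.\<close>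
      show ?thesis
        by (rule continuous_map_eq[of "cube k" euclideanreal "\<lambda>_. undefined"])
          (use False in \<open>auto simp: topspace_cube PiE_iff extensional_def\<close>)
    qed (rule continuous_map_cube_coordinate)
  qed
  then have "continuous_map (cube k) (top_of_set (topspace (cube k))) id"
    by (simp add: continuous_map_in_subtopology id_def)
  ultimately show ?thesis
    unfolding topology_eq using topology_finer_continuous_id[of "cube k" "top_of_set (topspace (cube k))"]
      topology_finer_continuous_id[of "top_of_set (topspace (cube k))" "cube k"]
    by auto
qed

lemma compact_topspace_cube: "compact (topspace (cube k))"
proof -
  have "compact_space (cube k)"
    by (auto simp: cube_def compact_space_product_topology compact_space_subtopology)
  then have "compact_space (top_of_set (topspace (cube k)))" using cube_eq_top_of_set[of k] by simp
  then show ?thesis by (simp add: compact_space_def compactin_subtopology)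
qed

text \<open>Distinct logarithms of one number are at least \<open>2 * pi\<close> apart, so a
  continuous path among them cannot move.\<close>

lemma exp_fibre_path_constant:
  assumes g: "continuous_on {0..1::real} g" and e: "\<And>s. s \<in> {0..1} \<Longrightarrow> exp (g s) = (z::complex)"
  shows "g 0 = g 1"
proof -
  have "g constant_on {0..1}"
  proof (rule continuous_discrete_range_constant[OF _ g])
    fix s assume s: "s \<in> {0..1::real}"
    have "2 * pi \<le> norm (g t - g s)" if t: "t \<in> {0..1}" "g t \<noteq> g s" for t
    proof -
      have "exp (g t) = exp (g s)" using e s t by simp
      then obtain n :: int where n: "g t = g s + of_int (2 * n) * pi * \<i>" by (auto simp: exp_eq)
      with t have "n \<noteq> 0" by auto
      then have "1 \<le> \<bar>real_of_int n\<bar>" by linarith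
      then show ?thesis using n by (simp add: norm_mult)
    qed
    then show "\<exists>e>0. \<forall>y. y \<in> {0..1} \<and> g y \<noteq> g s \<longrightarrow> e \<le> norm (g y - g s)"
      by (intro exI[of _ "2 * pi"]) auto
  qed auto
  then show ?thesis by (force simp: constant_on_def)
qed

text \<open>A based map has a logarithm on the cube. On the boundary this logarithm takes values in
  a discrete set, and the boundary is connected because \<open>k \<ge> 2\<close>, so it is constant
  there. Contracting the logarithm linearly to that constant gives a based homotopy.\<close>

lemma all_null_homotopic_punctured_plane:
  fixes z :: complex
  assumes k: "k \<ge> 2" and z: "z \<noteq> 0"
  shows "all_null_homotopic k (top_of_set (- {0})) z"
  unfolding all_null_homotopic_def
proof
  define Q where "Q = topspace (cube k)"
  have cube_Q: "cube k = top_of_set Q" using cube_eq_top_of_set[of k] by (simp add: Q_def)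
  fix f assume f: "f \<in> cube_maps k (top_of_set (- {0})) z"
  have contf: "continuous_on Q f" and fnz: "\<And>t. t \<in> Q \<Longrightarrow> f t \<noteq> 0"
    and fbd: "\<And>t. t \<in> cube_boundary k \<Longrightarrow> f t = z"
    using f by (auto simp: cube_maps_def based_map_def cube_Q)
  \<comment> \<open>Shrinking the cube to its corner makes \<open>f\<close> start at the constant
    \<open>z\<close>, as the lifting lemma requires; the logarithm of \<open>f\<close> itself is
    read off at parameter 1.\<close>
  define scale where "scale p = (\<lambda>i\<in>{..<k}. snd p * fst p i)" for p :: "(nat \<Rightarrow> real) \<times> real"
  have scale_in: "scale p \<in> Q" if "p \<in> Q \<times> {0..1}" for p
    using that mult_in_unit_interval[of "snd p" "fst p i" for i]
    by (simp add: scale_def Q_def topspace_cube PiE_iff mem_Times_iff)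
  have cont_into: "continuous_on S g" 
    if "\<And>x. x \<in> S \<Longrightarrow> g x \<in> Q" "\<And>i. i < k \<Longrightarrow> continuous_on S (\<lambda>x. g x i)"
    for S :: "'x::topological_space set" and g
  proof -
    have "continuous_map (top_of_set S) (cube k) g"
      using that by (auto simp: continuous_map_into_cube Q_def topspace_cube PiE_iff)
    then show ?thesis by (simp add: cube_Q)
  qed
  have "continuous_on (Q \<times> {0..1}) scale"
  proof (rule cont_into[OF scale_in])
    fix i assume "i < k"
    have "continuous_on (Q \<times> {0..1}) (\<lambda>p. fst p i)"
      by (rule continuous_on_product_then_coordinatewise[where f = fst, OF continuous_on_fst[OF continuous_on_id]])
    then have "continuous_on (Q \<times> {0..1}) (\<lambda>p. snd p * fst p i)"
      by (intro continuous_on_mult continuous_on_snd continuous_on_id)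
    then show "continuous_on (Q \<times> {0..1}) (\<lambda>p. scale p i)"
      using \<open>i < k\<close> by (simp add: scale_def)
  qed
  then have contF: "continuous_on (Q \<times> {0..1}) (\<lambda>p. f (scale p))"
    by (rule continuous_on_compose2[OF contf]) (use scale_in in auto)
  define c where "c = (\<lambda>i\<in>{..<k}. 0::real)"
  have c: "c \<in> cube_boundary k" unfolding c_def using k by (intro cube_boundary_nonempty) simp
  have "scale (t, 0) = c" for t by (auto simp: scale_def c_def)
  then have start: "f (scale (t, 0)) = z" for t using fbd[OF c] by simp
  obtain L where L: "continuous_on (Q \<times> {0..1}) L" "\<And>p. p \<in> Q \<times> {0..1} \<Longrightarrow> exp (L p) = f (scale p)"
    by (rule continuous_log_lift[OF compact_topspace_cube[of k, folded Q_def] contF])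
      (use fnz scale_in start in auto)
  define l where "l t = L (t, 1)" for t
  have contl: "continuous_on Q l"
    unfolding l_def by (rule continuous_on_compose2[OF L(1)]) (auto intro: continuous_intros)
  have scale1: "scale (t, 1) = t" if "t \<in> Q" for t
    using that by (auto simp: scale_def Q_def topspace_cube PiE_iff extensional_def)
  have expl: "exp (l t) = f t" if "t \<in> Q" for t
    using L(2)[of "(t, 1)"] that scale1 by (simp add: l_def)
  have bdQ: "cube_boundary k \<subseteq> Q" by (simp add: Q_def cube_boundary_subset)
  have move: "l (g 0) = l (g 1)" if g: "\<And>s. s \<in> {0..1} \<Longrightarrow> g s \<in> cube_boundary k"
    "\<And>i. i < k \<Longrightarrow> continuous_on {0..1::real} (\<lambda>s. g s i)" for g
  proof (rule exp_fibre_path_constant)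
    have "continuous_on {0..1} g" using g bdQ by (intro cont_into) auto
    then show "continuous_on {0..1} (\<lambda>s. l (g s))"
      by (rule continuous_on_compose2[OF contl]) (use g(1) bdQ in auto)
    show "exp (l (g s)) = z" if "s \<in> {0..1}" for s
      using expl[of "g s"] fbd[OF g(1)[OF that]] g(1)[OF that] bdQ by auto
  qed
  have lbd: "l t = l c" if t: "t \<in> cube_boundary k" for t
  proof -
    have tQ: "t \<in> Q" using t bdQ by blast
    obtain i where i: "i < k" "t i = 0 \<or> t i = 1" using t unfolding cube_boundary_def by blast
    \<comment> \<open>The path from \<open>t\<close> to the corner \<open>c\<close> stays in the
      boundary in two stages: first coordinate \<open>i\<close> keeps its value 0 or 1 while the
      others shrink, then \<open>i\<close> shrinks while coordinate \<open>j\<close> is already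
      0.\<close>
    obtain j where j: "j < k" "j \<noteq> i"
      using k by (metis Suc_1 Suc_le_lessD less_le_trans n_not_Suc_n not_gr_zero pos2 zero_less_one)
    define t' where "t' = (\<lambda>m\<in>{..<k}. if m = i then t i else 0)"
    have bounds: "0 \<le> t m" "t m \<le> 1" if "m < k" for m
      using tQ that by (auto simp: Q_def topspace_cube PiE_iff)
    have "l (\<lambda>m\<in>{..<k}. if m = i then t i else (1 - 0) * t m) =
        l (\<lambda>m\<in>{..<k}. if m = i then t i else (1 - 1) * t m)"
    proof (rule move[of "\<lambda>s. \<lambda>m\<in>{..<k}. if m = i then t i else (1 - s) * t m"])
      show "(\<lambda>m\<in>{..<k}. if m = i then t i else (1 - s) * t m) \<in> cube_boundary k"
        if "s \<in> {0..1}" for s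
        using that i bounds mult_in_unit_interval[of "1 - s" "t m" for m]
        by (auto simp: cube_boundary_def topspace_cube intro!: exI[of _ i])
      show "continuous_on {0..1} (\<lambda>s. (\<lambda>m\<in>{..<k}. if m = i then t i else (1 - s) * t m) m)"
        if "m < k" for m
        using that by (cases "m = i") (auto intro!: continuous_intros)
    qed
    moreover have "(\<lambda>m\<in>{..<k}. if m = i then t i else (1 - 0) * t m) = t"
      using tQ by (auto simp: Q_def topspace_cube PiE_iff extensional_def)
    moreover have "(\<lambda>m\<in>{..<k}. if m = i then t i else (1 - 1) * t m) = t'"
      by (auto simp: t'_def)
    ultimately have 1: "l t = l t'" by simp
    have "l (\<lambda>m\<in>{..<k}. if m = i then (1 - 0) * t i else 0) =
        l (\<lambda>m\<in>{..<k}. if m = i then (1 - 1) * t i else 0)"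
    proof (rule move[of "\<lambda>s. \<lambda>m\<in>{..<k}. if m = i then (1 - s) * t i else 0"])
      show "(\<lambda>m\<in>{..<k}. if m = i then (1 - s) * t i else 0) \<in> cube_boundary k"
        if "s \<in> {0..1}" for s
        using that i j bounds mult_in_unit_interval[of "1 - s" "t i"]
        by (auto simp: cube_boundary_def topspace_cube intro!: exI[of _ j])
      show "continuous_on {0..1} (\<lambda>s. (\<lambda>m\<in>{..<k}. if m = i then (1 - s) * t i else 0) m)"
        if "m < k" for m
        using that by (cases "m = i") (auto intro!: continuous_intros)
    qed
    moreover have "(\<lambda>m\<in>{..<k}. if m = i then (1 - 1) * t i else 0) = c"
      by (auto simp: c_def)
    moreover have "(\<lambda>m\<in>{..<k}. if m = i then (1 - 0) * t i else 0) = t'"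
      by (auto simp: t'_def)
    ultimately have 2: "l t' = l c" by simp
    show ?thesis using 1 2 by simp
  qed
  \<comment> \<open>A convex combination of logarithms, exponentiated, cannot hit 0.\<close>
  let ?h = "\<lambda>p. exp ((1 - of_real (fst p)) * l (snd p) + of_real (fst p) * l c)"
  have exp_c: "exp (l c) = z" using expl[of c] fbd[OF c] c bdQ by auto
  have "continuous_on ({0..1} \<times> Q) ?h"
    by (intro continuous_intros continuous_on_compose2[OF contl]) auto
  then have "homotopic_with (based_map k z) (cube k) (top_of_set (- {0})) f (\<lambda>_. z)"
    unfolding homotopic_based_iff
    by (intro exI[of _ ?h])
      (auto simp: cube_Q expl exp_c lbd algebra_simps continuous_map_in_subtopology)
  then show "homotopic_with (based_map k z) (cube k) (top_of_set (- {0})) f (\<lambda>_. z)" .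
qed

section \<open>The Hopf map\<close>

text \<open>For unit \<open>q = (\<zeta>, h)\<close>, \<open>line_proj q\<close> is \<open>(I + B) / 2\<close> for the traceless hermitian \<open>B\<close> with rows
  \<open>(h, \<zeta>)\<close> and \<open>(cnj \<zeta>, - h)\<close>: the orthogonal projection onto the eigenline of \<open>B\<close> for the eigenvalue
  \<open>1\<close>. The Hopf map inverts this, sending \<open>v \<noteq> 0\<close> to the \<open>q\<close> whose line contains \<open>v\<close>.\<close>
definition line_proj :: "complex \<times> real \<Rightarrow> complex \<times> complex \<Rightarrow> complex \<times> complex" where
  "line_proj q v = (((1 + of_real (snd q)) * fst v + fst q * snd v) / 2,
    (cnj (fst q) * fst v + (1 - of_real (snd q)) * snd v) / 2)"

definition hopf :: "complex \<times> complex \<Rightarrow> complex \<times> real" where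
  "hopf v = (2 * fst v * cnj (snd v) / of_real ((norm v)\<^sup>2),
    ((norm (fst v))\<^sup>2 - (norm (snd v))\<^sup>2) / (norm v)\<^sup>2)"

definition cscale :: "complex \<Rightarrow> complex \<times> complex \<Rightarrow> complex \<times> complex" where
  "cscale c v = (c * fst v, c * snd v)"

text \<open>The hermitian inner product of \<open>w\<close> with \<open>v\<close>, divided by that
  of \<open>v\<close> with itself: the coefficient of \<open>v\<close> in the orthogonal projection
  of \<open>w\<close>.\<close>

definition line_coeff :: "complex \<times> complex \<Rightarrow> complex \<times> complex \<Rightarrow> complex" where
  "line_coeff v w = (fst w * cnj (fst v) + snd w * cnj (snd v)) / of_real ((norm v)\<^sup>2)"

lemma norm_prod_squared: "(norm v)\<^sup>2 = (norm (fst v))\<^sup>2 + (norm (snd v))\<^sup>2"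
  by (simp add: norm_prod_def)

lemma of_real_norm_squared:
  "complex_of_real ((norm v)\<^sup>2) = fst v * cnj (fst v) + snd v * cnj (snd v)"
  unfolding norm_prod_squared of_real_add complex_norm_square by (simp add: mult.commute)

text \<open>The sphere equation as a polynomial identity over the complex numbers, the form that
  \<open>algebra\<close> can use.\<close>

lemma unit_sphere_relation:
  assumes "q \<in> sphere 0 (1::real)"
  shows "fst q * cnj (fst q) = 1 - (complex_of_real (snd q))\<^sup>2"
proof -
  have "(norm q)\<^sup>2 = 1" using assms by simp
  then have "complex_of_real ((norm (fst q))\<^sup>2) = of_real (1 - (snd q)\<^sup>2)"
    unfolding norm_prod_squared by (simp only: of_real_eq_iff) simp
  then show ?thesis by (simp only: complex_norm_square) simp
qed

text \<open>For unit \<open>q\<close> the matrix B squares to the identity, so (I + B) / 2 is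
  idempotent. The two displayed identities are this, cleared of denominators.\<close>

lemma line_proj_idem:
  assumes "q \<in> sphere 0 1"
  shows "line_proj q (line_proj q v) = line_proj q v"
proof -
  note u = unit_sphere_relation[OF assms]
  obtain z w where v: "v = (z, w)" by force
  define \<zeta> h where "\<zeta> = fst q" and "h = complex_of_real (snd q)"
  have u: "\<zeta> * cnj \<zeta> = 1 - h\<^sup>2" using u by (simp add: \<zeta>_def h_def)
  have "(1 + h) * ((1 + h) * z + \<zeta> * w) + \<zeta> * (cnj \<zeta> * z + (1 - h) * w) = 2 * ((1 + h) * z + \<zeta> * w)"
    using u by algebra
  moreover have "cnj \<zeta> * ((1 + h) * z + \<zeta> * w) + (1 - h) * (cnj \<zeta> * z + (1 - h) * w)
      = 2 * (cnj \<zeta> * z + (1 - h) * w)"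
    using u by algebra
  ultimately show ?thesis
    unfolding line_proj_def v \<zeta>_def[symmetric] h_def[symmetric]
    by (simp add: prod_eq_iff)
qed

lemma line_proj_fixed_iff:
  "line_proj q v = v \<longleftrightarrow>
    fst q * snd v = (1 - of_real (snd q)) * fst v \<and> cnj (fst q) * fst v = (1 + of_real (snd q)) * snd v"
  by (auto simp: line_proj_def prod_eq_iff field_simps)

lemma norm_hopf:
  assumes "v \<noteq> 0"
  shows "hopf v \<in> sphere 0 1"
proof -
  have n: "(norm v)\<^sup>2 \<noteq> 0" using assms by simp
  define a b where "a = (norm (fst v))\<^sup>2" and "b = (norm (snd v))\<^sup>2"
  have "(norm (hopf v))\<^sup>2 = (4 * a * b + (a - b)\<^sup>2) / ((norm v)\<^sup>2)\<^sup>2"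
    unfolding norm_prod_squared[of "hopf v"]
    unfolding hopf_def fst_conv snd_conv norm_divide norm_mult norm_of_real
    by (simp add: a_def b_def power_divide power_mult_distrib add_divide_distrib)
  also have "4 * a * b + (a - b)\<^sup>2 = ((norm v)\<^sup>2)\<^sup>2"
    unfolding norm_prod_squared[of v] a_def[symmetric] b_def[symmetric]
    by (simp add: power2_eq_square algebra_simps)
  finally have "(norm (hopf v))\<^sup>2 = 1" using n by simp
  then show ?thesis by (simp add: power2_eq_1_iff) (smt (verit) norm_ge_zero)
qed

lemma line_proj_hopf:
  assumes "v \<noteq> 0"
  shows "line_proj (hopf v) v = v"
proof -
  obtain z w where v: "v = (z, w)" by force
  have n: "complex_of_real ((norm v)\<^sup>2) \<noteq> 0" using assms by simp
  have r: "complex_of_real (((norm (fst v))\<^sup>2 - (norm (snd v))\<^sup>2) / (norm v)\<^sup>2) =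
      (z * cnj z - w * cnj w) / of_real ((norm v)\<^sup>2)"
    by (simp only: of_real_divide of_real_diff complex_norm_square v fst_conv snd_conv)
  have N: "complex_of_real ((norm v)\<^sup>2) = z * cnj z + w * cnj w"
    using of_real_norm_squared[of v] by (simp add: v)
  have N0: "z * cnj z + w * cnj w \<noteq> 0" using n unfolding N .
  show ?thesis
    unfolding line_proj_fixed_iff hopf_def fst_conv snd_conv r N unfolding v fst_conv snd_conv
    using N0 by (simp add: divide_simps) (simp add: algebra_simps)
qed

lemma hopf_eq:
  assumes q: "q \<in> sphere 0 1" and v: "v \<noteq> 0" and fixed: "line_proj q v = v"
  shows "hopf v = q"
proof -
  obtain z w where vzw: "v = (z, w)" by force
  define \<zeta> h where "\<zeta> = fst q" and "h = complex_of_real (snd q)"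
  have u: "\<zeta> * cnj \<zeta> = 1 - h\<^sup>2" using unit_sphere_relation[OF q] by (simp add: \<zeta>_def h_def)
  have 1: "\<zeta> * w = (1 - h) * z" and 2: "cnj \<zeta> * z = (1 + h) * w"
    using fixed unfolding line_proj_fixed_iff by (simp_all add: vzw \<zeta>_def h_def)
  have 3: "cnj \<zeta> * cnj w = (1 - h) * cnj z" and 4: "\<zeta> * cnj z = (1 + h) * cnj w"
    using arg_cong[OF 1, of cnj] arg_cong[OF 2, of cnj] by (simp_all add: h_def)
  have N: "complex_of_real ((norm v)\<^sup>2) = z * cnj z + w * cnj w"
    using of_real_norm_squared[of v] by (simp add: vzw)
  have "complex_of_real ((norm v)\<^sup>2) \<noteq> 0" using v by simp
  then have N0: "z * cnj z + w * cnj w \<noteq> 0" unfolding N .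
  have a: "2 * z * cnj w = \<zeta> * (z * cnj z + w * cnj w)"
    using 1 4 by algebra
  have b: "z * cnj z - w * cnj w = h * (z * cnj z + w * cnj w)"
    using 1 2 3 4 by algebra
  have "complex_of_real (snd (hopf v)) = h"
    unfolding hopf_def snd_conv of_real_divide of_real_diff complex_norm_square N
    using N0 b by (simp add: vzw divide_simps)
  moreover have "fst (hopf v) = \<zeta>"
    unfolding hopf_def fst_conv N using N0 a by (simp add: vzw divide_simps)
  ultimately show ?thesis by (simp add: prod_eq_iff \<zeta>_def h_def)
qed

text \<open>If \<open>v\<close> is fixed by one projection and killed by the other, then half the
  difference of the two matrices B fixes \<open>v\<close>. This operator multiplies norms by half
  the distance of \<open>q\<close> and \<open>q'\<close>, which is less than 1. On the unit sphere
  the bound 2 excludes just the antipode, whose line is the orthogonal one.\<close>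

lemma line_proj_nonzero:
  assumes fixed: "line_proj q v = v" and v: "v \<noteq> 0" and d: "dist q' q < 2"
  shows "line_proj q' v \<noteq> 0"
proof
  assume 0: "line_proj q' v = 0"
  obtain z w where vzw: "v = (z, w)" by force
  define \<zeta> h where "\<zeta> = fst (q - q')" and "h = snd (q - q')"
  have "line_proj q v - line_proj q' v = ((h * z + \<zeta> * w) / 2, (cnj \<zeta> * z - h * w) / 2)"
    by (simp add: line_proj_def vzw \<zeta>_def h_def field_simps)
  then have "v = ((h * z + \<zeta> * w) / 2, (cnj \<zeta> * z - h * w) / 2)" using 0 fixed by simp
  then have z: "2 * z = h * z + \<zeta> * w" and w: "2 * w = cnj \<zeta> * z - h * w"
    by (auto simp: vzw mult.commute)
  have zc: "2 * cnj z = h * cnj z + cnj \<zeta> * cnj w" and wc: "2 * cnj w = \<zeta> * cnj z - h * cnj w"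
    using arg_cong[OF z, of cnj] arg_cong[OF w, of cnj] by simp_all
  have "4 * (z * cnj z + w * cnj w) = (2 * z) * (2 * cnj z) + (2 * w) * (2 * cnj w)"
    by (simp add: algebra_simps)
  also have "\<dots> = (\<zeta> * cnj \<zeta> + of_real h * of_real h) * (z * cnj z + w * cnj w)"
    unfolding z zc w wc by (simp add: algebra_simps)
  finally have "complex_of_real (4 * (norm v)\<^sup>2) = of_real ((norm (q - q'))\<^sup>2 * (norm v)\<^sup>2)"
    unfolding of_real_mult of_real_norm_squared
    unfolding norm_prod_squared of_real_add complex_norm_square
    by (simp add: vzw \<zeta>_def h_def power2_eq_square)
  then have "4 * (norm v)\<^sup>2 = (norm (q - q'))\<^sup>2 * (norm v)\<^sup>2" by (simp only: of_real_eq_iff)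
  then have "(norm (q - q'))\<^sup>2 = 2\<^sup>2" using v by simp
  then have "norm (q - q') = 2" by (rule power2_eq_imp_eq) auto
  then show False using d by (simp add: dist_norm norm_minus_commute)
qed

lemma cscale_line_coeff:
  assumes v: "v \<noteq> 0" and q: "line_proj q v = v" "line_proj q w = w"
  shows "cscale (line_coeff v w) v = w"
proof -
  obtain a b where va: "v = (a, b)" by force
  obtain c d where wc: "w = (c, d)" by force
  note vw = va wc
  define \<zeta> h where "\<zeta> = fst q" and "h = complex_of_real (snd q)"
  have 1: "\<zeta> * b = (1 - h) * a" "cnj \<zeta> * a = (1 + h) * b"
    and 2: "\<zeta> * d = (1 - h) * c" "cnj \<zeta> * c = (1 + h) * d"
    using q unfolding line_proj_fixed_iff by (simp_all add: vw \<zeta>_def h_def)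
  have "(1 - h) * (a * d) = (1 - h) * (b * c)" "(1 + h) * (a * d) = (1 + h) * (b * c)"
    using 1 2 by (algebra, algebra)
  \<comment> \<open>Either of the factors \<open>1 - h\<close> and \<open>1 + h\<close> may vanish,
    but their sum is 2. The vanishing of the 2 by 2 determinant says that \<open>v\<close> and
    \<open>w\<close> are proportional.\<close>
  then have cross: "a * d = b * c" by algebra
  have N: "complex_of_real ((norm v)\<^sup>2) = a * cnj a + b * cnj b"
    using of_real_norm_squared[of v] by (simp add: vw)
  have "complex_of_real ((norm v)\<^sup>2) \<noteq> 0" using v by simp
  then have N0: "a * cnj a + b * cnj b \<noteq> 0" unfolding N .
  have "(c * cnj a + d * cnj b) * a = c * (a * cnj a + b * cnj b)"
    "(c * cnj a + d * cnj b) * b = d * (a * cnj a + b * cnj b)"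
    using cross by (algebra, algebra)
  then show ?thesis unfolding cscale_def line_coeff_def N using N0 by (simp add: vw)
qed

lemma line_coeff_cscale: "v \<noteq> 0 \<Longrightarrow> line_coeff v (cscale c v) = c"
proof -
  assume "v \<noteq> 0"
  then have "complex_of_real ((norm v)\<^sup>2) \<noteq> 0" by simp
  then show ?thesis
    unfolding line_coeff_def cscale_def of_real_norm_squared by (simp add: field_simps)
qed

lemma cscale_simps [simp]: "cscale 1 v = v" "cscale c (cscale d v) = cscale (c * d) v"
  by (simp_all add: cscale_def mult.assoc)

lemma cscale_eq_0_iff [simp]: "cscale c v = 0 \<longleftrightarrow> c = 0 \<or> v = 0"
  by (auto simp: cscale_def prod_eq_iff)

lemma line_proj_cscale: "line_proj q v = v \<Longrightarrow> line_proj q (cscale c v) = cscale c v"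
  unfolding line_proj_fixed_iff by (simp add: cscale_def mult.left_commute)

lemma hopf_cscale:
  assumes "c \<noteq> 0" "v \<noteq> 0"
  shows "hopf (cscale c v) = hopf v"
  using assms by (intro hopf_eq norm_hopf line_proj_cscale line_proj_hopf) auto

lemma scaleR_conv_cscale: "a *\<^sub>R v = cscale (of_real a) v"
  by (simp add: cscale_def scaleR_conv_of_real prod_eq_iff)

lemma continuous_on_line_proj [continuous_intros]:
  assumes "continuous_on S f" "continuous_on S g"
  shows "continuous_on S (\<lambda>x. line_proj (f x) (g x))"
  unfolding line_proj_def by (intro continuous_intros assms) auto

lemma continuous_on_hopf [continuous_intros]:
  assumes "continuous_on S f" "\<And>x. x \<in> S \<Longrightarrow> f x \<noteq> 0"
  shows "continuous_on S (\<lambda>x. hopf (f x))"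
  unfolding hopf_def using assms(2) by (intro continuous_intros assms(1)) auto

lemma continuous_on_cscale [continuous_intros]:
  assumes "continuous_on S f" "continuous_on S g"
  shows "continuous_on S (\<lambda>x. cscale (f x) (g x))"
  unfolding cscale_def by (intro continuous_intros assms)

lemma continuous_on_line_coeff [continuous_intros]:
  assumes "continuous_on S f" "continuous_on S g" "\<And>x. x \<in> S \<Longrightarrow> f x \<noteq> 0"
  shows "continuous_on S (\<lambda>x. line_coeff (f x) (g x))"
  unfolding line_coeff_def using assms(3) by (intro continuous_intros assms(1,2)) auto

text \<open>The projection has trace 1, so its two columns cannot both vanish.\<close>

lemma line_nonempty:
  assumes q: "q \<in> sphere 0 1"
  obtains v where "v \<noteq> 0" "line_proj q v = v"
proof -
  let ?v = "line_proj q (1, 0)" and ?w = "line_proj q (0, 1)"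
  have "?v \<noteq> 0 \<or> ?w \<noteq> 0"
  proof (rule ccontr)
    assume "\<not> (?v \<noteq> 0 \<or> ?w \<noteq> 0)"
    then have "1 + complex_of_real (snd q) = 0" "1 - complex_of_real (snd q) = 0"
      by (auto simp: line_proj_def prod_eq_iff)
    then show False by simp
  qed
  then show ?thesis using that line_proj_idem[OF q] by blast
qed

section \<open>Lifts through the Hopf map\<close>

text \<open>Transport starts at \<open>v0\<close> and projects onto the lines of the successive
  sample points. Where the path in the base is constant, every projection fixes \<open>v0\<close>;
  the last conclusion records this, and it is what makes lifts constant on sides of the
  square.\<close>

lemma hopf_lift:
  fixes F :: "'a::metric_space \<times> real \<Rightarrow> complex \<times> real"
  assumes v0: "v0 \<noteq> 0" "line_proj q0 v0 = v0"
    and K: "compact K" and F: "continuous_on (K \<times> {0..1}) F"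
    and sph: "\<And>p. p \<in> K \<times> {0..1} \<Longrightarrow> F p \<in> sphere 0 1" and start: "\<And>y. y \<in> K \<Longrightarrow> F (y, 0) = q0"
  obtains V where "continuous_on (K \<times> {0..1}) V"
    "\<And>p. p \<in> K \<times> {0..1} \<Longrightarrow> V p \<noteq> 0 \<and> line_proj (F p) (V p) = V p"
    "\<And>y. y \<in> K \<Longrightarrow> V (y, 0) = v0"
    "\<And>y s. y \<in> K \<Longrightarrow> (\<And>s. s \<in> {0..1} \<Longrightarrow> F (y, s) = q0) \<Longrightarrow> s \<in> {0..1} \<Longrightarrow> V (y, s) = v0"
proof -
  \<comment> \<open>The mesh 2 is the bound under which \<open>line_proj_nonzero\<close> keeps the
    transported vector nonzero.\<close>
  obtain N :: nat where N: "N > 0"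
    "\<And>y s i. y \<in> K \<Longrightarrow> s \<in> {0..1} \<Longrightarrow> i < N \<Longrightarrow>
      dist (F (y, real (Suc i) / N * s)) (F (y, real i / N * s)) < 2"
    by (rule uniform_subdivision[OF K F, of 2]) auto
  define W where "W i = rec_nat (\<lambda>p. v0)
    (\<lambda>i w p. line_proj (F (fst p, real (Suc i) / N * snd p)) (w p)) i" for i
  have W0: "W 0 p = v0"
    and WS: "W (Suc i) p = line_proj (F (fst p, real (Suc i) / N * snd p)) (W i p)" for i p
    by (simp_all add: W_def)
  have in01: "real i / N * s \<in> {0..1}" if "i \<le> N" "s \<in> {0..1}" for i s
    using that N(1) by (intro mult_in_unit_interval) auto
  have inv: "continuous_on (K \<times> {0..1}) (W i) \<and> (\<forall>y\<in>K. \<forall>s\<in>{0..1}. W i (y, s) \<noteq> 0 \<and>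
      line_proj (F (y, real i / N * s)) (W i (y, s)) = W i (y, s) \<and>
      ((\<forall>s\<in>{0..1}. F (y, s) = q0) \<longrightarrow> W i (y, s) = v0) \<and> W i (y, 0) = v0)"
    if "i \<le> N" for i
    using that
  proof (induction i)
    case 0
    then show ?case using v0 start by (simp add: W0[abs_def])
  next
    case (Suc i)
    then have IH: "continuous_on (K \<times> {0..1}) (W i)"
      "\<And>y s. y \<in> K \<Longrightarrow> s \<in> {0..1} \<Longrightarrow> W i (y, s) \<noteq> 0 \<and>
        line_proj (F (y, real i / N * s)) (W i (y, s)) = W i (y, s) \<and>
        ((\<forall>s\<in>{0..1}. F (y, s) = q0) \<longrightarrow> W i (y, s) = v0) \<and> W i (y, 0) = v0"
      by auto
    have "real (Suc i) / N \<in> {0..1}" using Suc.prems by auto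
    then have "continuous_on (K \<times> {0..1}) (W (Suc i))"
      unfolding WS[abs_def] by (intro continuous_on_line_proj continuous_on_rescale F IH(1))
    moreover have "W (Suc i) (y, s) \<noteq> 0 \<and>
        line_proj (F (y, real (Suc i) / N * s)) (W (Suc i) (y, s)) = W (Suc i) (y, s) \<and>
        ((\<forall>s\<in>{0..1}. F (y, s) = q0) \<longrightarrow> W (Suc i) (y, s) = v0) \<and> W (Suc i) (y, 0) = v0"
      if y: "y \<in> K" and s: "s \<in> {0..1}" for y s
    proof (intro conjI impI)
      show "W (Suc i) (y, s) \<noteq> 0"
        unfolding WS fst_conv snd_conv
        using IH(2)[OF y s] N(2)[OF y s, of i] Suc.prems by (intro line_proj_nonzero) auto
      show "line_proj (F (y, real (Suc i) / N * s)) (W (Suc i) (y, s)) = W (Suc i) (y, s)"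
        unfolding WS fst_conv snd_conv
        using in01[OF Suc.prems s] y by (intro line_proj_idem sph) auto
      show "W (Suc i) (y, s) = v0" if "\<forall>s\<in>{0..1}. F (y, s) = q0"
        unfolding WS fst_conv snd_conv using IH(2)[OF y s] in01[OF Suc.prems s] that v0 by auto
      show "W (Suc i) (y, 0) = v0"
        unfolding WS fst_conv snd_conv using IH(2)[OF y s] start[OF y] v0 by simp
    qed
    ultimately show ?case by blast
  qed
  have WN: "W N (y, s) \<noteq> 0" "line_proj (F (y, s)) (W N (y, s)) = W N (y, s)"
    "(\<forall>s\<in>{0..1}. F (y, s) = q0) \<longrightarrow> W N (y, s) = v0" "W N (y, 0) = v0"
    if "y \<in> K" "s \<in> {0..1}" for y s
    using inv[of N] that N(1) by auto
  show ?thesis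
    by (rule that[of "W N"]) (use inv[of N] WN WN(4)[of _ 0] in auto)
qed

text \<open>Pairs of reals form a euclidean space, as the extension results for boxes demand;
  functions on \<open>nat\<close> do not.\<close>

definition unit_square :: "(real \<times> real) set" where
  "unit_square = {0..1} \<times> {0..1}"

lemma compact_unit_square: "compact unit_square"
  by (simp add: unit_square_def compact_Times)

locale hopf_base =
  fixes q0 :: "complex \<times> real" and v0 :: "complex \<times> complex"
  assumes q0: "q0 \<in> sphere 0 1" and v0: "v0 \<noteq> 0" "line_proj q0 v0 = v0"
begin

definition square_map :: "(real \<times> real \<Rightarrow> complex \<times> real) \<Rightarrow> bool" where
  "square_map G \<longleftrightarrow> continuous_on unit_square G \<and> G \<in> unit_square \<rightarrow> sphere 0 1 \<and>
    (\<forall>s\<in>{0..1}. G (s, 0) = q0 \<and> G (s, 1) = q0 \<and> G (0, s) = q0 \<and> G (1, s) = q0)"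

definition square_homotopic ::
    "(real \<times> real \<Rightarrow> complex \<times> real) \<Rightarrow> (real \<times> real \<Rightarrow> complex \<times> real) \<Rightarrow> bool" where
  "square_homotopic G G' \<longleftrightarrow> (\<exists>H. continuous_on ({0..1} \<times> unit_square) H \<and>
    H \<in> {0..1} \<times> unit_square \<rightarrow> sphere 0 1 \<and>
    (\<forall>t\<in>unit_square. H (0::real, t) = G t \<and> H (1, t) = G' t) \<and>
    (\<forall>u\<in>{0..1}. \<forall>s\<in>{0..1}. H (u, (s, 0)) = q0 \<and> H (u, (s, 1)) = q0 \<and>
      H (u, (0, s)) = q0 \<and> H (u, (1, s)) = q0))"

text \<open>Nothing is prescribed on the side where the second coordinate is 1: there the lift may
  turn within the line of \<open>q0\<close>, and \<open>phase\<close> measures that turning.\<close>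

definition square_lift ::
    "(real \<times> real \<Rightarrow> complex \<times> real) \<Rightarrow> (real \<times> real \<Rightarrow> complex \<times> complex) \<Rightarrow> bool" where
  "square_lift G V \<longleftrightarrow> continuous_on unit_square V \<and>
    (\<forall>t\<in>unit_square. V t \<noteq> 0 \<and> line_proj (G t) (V t) = V t) \<and>
    (\<forall>s\<in>{0..1}. V (s, 0) = v0 \<and> V (0, s) = v0 \<and> V (1, s) = v0)"

definition phase :: "(real \<times> real \<Rightarrow> complex \<times> complex) \<Rightarrow> real \<Rightarrow> complex" where
  "phase V s = line_coeff v0 (V (s, 1))"

lemma square_lift_exists:
  assumes G: "square_map G"
  obtains V where "square_lift G V"
proof -
  have "continuous_on ({0..1} \<times> {0..1}) G" "\<And>p. p \<in> {0..1} \<times> {0..1} \<Longrightarrow> G p \<in> sphere 0 1"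
    "\<And>y. y \<in> {0..1} \<Longrightarrow> G (y, 0) = q0"
    using G by (auto simp: square_map_def unit_square_def)
  \<comment> \<open>Transport runs in the second coordinate with the first as parameter. The first
    coordinate is thus left free for concatenation.\<close>
  from hopf_lift[OF v0 compact_Icc this]
  obtain V where V: "continuous_on ({0..1} \<times> {0..1}) V"
    "\<And>p. p \<in> {0..1} \<times> {0..1} \<Longrightarrow> V p \<noteq> 0 \<and> line_proj (G p) (V p) = V p"
    "\<And>y. y \<in> {0..1} \<Longrightarrow> V (y, 0) = v0"
    "\<And>y s. y \<in> {0..1} \<Longrightarrow> (\<And>s. s \<in> {0..1} \<Longrightarrow> G (y, s) = q0) \<Longrightarrow> s \<in> {0..1} \<Longrightarrow> V (y, s) = v0"
    by blast
  have "square_lift G V"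
    unfolding square_lift_def unit_square_def
    using V(1-3) V(4)[of 0] V(4)[of 1] G by (auto simp: square_map_def)
  then show ?thesis by (rule that)
qed

lemma phase_loop:
  assumes G: "square_map G" and V: "square_lift G V"
  shows "path (phase V)" "path_image (phase V) \<subseteq> - {0}" "pathstart (phase V) = 1"
    "pathfinish (phase V) = 1" "\<And>s. s \<in> {0..1} \<Longrightarrow> V (s, 1) = cscale (phase V s) v0"
    "\<And>s. s \<in> {0..1} \<Longrightarrow> phase V s \<noteq> 0"
proof -
  have one: "line_coeff v0 v0 = 1" using line_coeff_cscale[OF v0(1), of 1] by simp
  show lam: "V (s, 1) = cscale (phase V s) v0" if "s \<in> {0..1}" for s
  proof -
    have "(s, 1) \<in> unit_square" "G (s, 1) = q0"
      using that G by (auto simp: square_map_def unit_square_def)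
    moreover have "line_proj (G (s, 1)) (V (s, 1)) = V (s, 1)"
      using \<open>(s, 1) \<in> unit_square\<close> V by (auto simp: square_lift_def)
    ultimately show ?thesis using cscale_line_coeff[OF v0, of "V (s, 1)"] by (simp add: phase_def)
  qed
  show nz: "phase V s \<noteq> 0" if "s \<in> {0..1}" for s
  proof -
    have "V (s, 1) \<noteq> 0" using that V by (auto simp: square_lift_def unit_square_def)
    then show ?thesis using lam[OF that] by auto
  qed
  have "continuous_on {0..1} (\<lambda>s. V (s, 1))"
  proof (rule continuous_on_compose2[of unit_square V])
    show "continuous_on unit_square V" using V by (simp add: square_lift_def)
  qed (auto simp: unit_square_def intro!: continuous_intros)
  then have "continuous_on {0..1} (phase V)"
    unfolding phase_def[abs_def] using v0 by (intro continuous_intros) auto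
  then show "path (phase V)" by (simp add: path_def)
  show "path_image (phase V) \<subseteq> - {0}" using nz by (auto simp: path_image_def)
  show "pathstart (phase V) = 1" "pathfinish (phase V) = 1"
    using V one by (auto simp: square_lift_def phase_def pathstart_def pathfinish_def)
qed

text \<open>Two lifts differ by a factor on the whole square, which contracts the quotient of the phases.\<close>
lemma homotopic_paths_phase_unique:
  assumes G: "square_map G" and V: "square_lift G V" and W: "square_lift G W"
  shows "homotopic_paths (- {0}) (phase V) (phase W)"
proof -
  define c where "c t = line_coeff (V t) (W t)" for t
  have cW: "cscale (c t) (V t) = W t" if "t \<in> unit_square" for t
    unfolding c_def using that V W by (intro cscale_line_coeff) (auto simp: square_lift_def)
  have c1: "c t = 1" if "t \<in> unit_square" "V t = W t" for t
    using line_coeff_cscale[of "V t" 1] that V by (auto simp: c_def square_lift_def)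
  have cnz: "c t \<noteq> 0" if "t \<in> unit_square" for t
    using cW[OF that] that W cscale_eq_0_iff[of "c t" "V t"] by (auto simp: square_lift_def)
  have contc: "continuous_on unit_square c"
    unfolding c_def[abs_def] using V W by (intro continuous_intros) (auto simp: square_lift_def)
  note pV = phase_loop[OF G V] and pW = phase_loop[OF G W]
  have prod: "c (s, 1) * phase V s = phase W s" if "s \<in> {0..1}" for s
  proof -
    have "cscale (c (s, 1) * phase V s) v0 = cscale (phase W s) v0"
      using cW[of "(s, 1)"] pV(5)[OF that] pW(5)[OF that] that by (simp add: unit_square_def)
    then show ?thesis using line_coeff_cscale[OF v0(1)] by metis
  qed
  \<comment> \<open>The factor \<open>c\<close> is 1 on three sides. On the bottom side it leaves
    \<open>phase V\<close> unchanged, on the top side it turns it into \<open>phase W\<close>, and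
    on the vertical sides it keeps the end points of the loop fixed.\<close>
  let ?h = "\<lambda>p. c (snd p, fst p) * phase V (snd p)"
  have "continuous_on ({0..1} \<times> {0..1}) ?h"
    by (intro continuous_intros continuous_on_compose2[OF contc]
        continuous_on_compose2[OF pV(1)[unfolded path_def]]) (auto simp: unit_square_def)
  moreover have "c (s, 0) = 1" "c (0, s) = 1" "c (1, s) = 1" if s: "s \<in> {0..1}" for s
  proof -
    have "V (s, 0) = W (s, 0)" "V (0, s) = W (0, s)" "V (1, s) = W (1, s)"
      using V W s unfolding square_lift_def by metis+
    moreover have "(s, 0) \<in> unit_square" "(0, s) \<in> unit_square" "(1, s) \<in> unit_square"
      using s by (auto simp: unit_square_def)
    ultimately show "c (s, 0) = 1" "c (0, s) = 1" "c (1, s) = 1" by (simp_all add: c1)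
  qed
  ultimately show ?thesis
    unfolding homotopic_paths
    using pV prod cnz
    by (intro exI[of _ ?h]) (auto simp: unit_square_def pathstart_def pathfinish_def)
qed

text \<open>The whole homotopy is lifted at once; the slices \<open>Y u\<close> lift the
  intermediate maps, and their phases form a homotopy of loops. Uniqueness of phases then replaces
  the end slices by the given lifts.\<close>

lemma homotopic_paths_phase:
  assumes G: "square_map G" and G': "square_map G'" and V: "square_lift G V" and W: "square_lift G' W"
    and "square_homotopic G G'"
  shows "homotopic_paths (- {0}) (phase V) (phase W)"
proof -
  obtain H where H: "continuous_on ({0..1} \<times> unit_square) H"
    "H \<in> {0..1} \<times> unit_square \<rightarrow> sphere 0 1"
    "\<And>t. t \<in> unit_square \<Longrightarrow> H (0::real, t) = G t \<and> H (1, t) = G' t"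
    "\<And>u s. u \<in> {0..1} \<Longrightarrow> s \<in> {0..1} \<Longrightarrow> H (u, (s, 0)) = q0 \<and> H (u, (s, 1)) = q0 \<and>
      H (u, (0, s)) = q0 \<and> H (u, (1, s)) = q0"
    using assms(5) unfolding square_homotopic_def by blast
  \<comment> \<open>The arguments are regrouped so that transport runs in the last coordinate, with
    homotopy time and first coordinate as parameters.\<close>
  let ?F = "\<lambda>p. H (fst (fst p), (snd (fst p), snd p))"
  have "continuous_on (unit_square \<times> {0..1}) ?F"
    by (rule continuous_on_compose2[OF H(1)]) (auto simp: unit_square_def intro!: continuous_intros)
  moreover have "?F p \<in> sphere 0 1" if "p \<in> unit_square \<times> {0..1}" for p
    using that H(2) by (auto simp: unit_square_def Pi_iff)
  moreover have "?F (y, 0) = q0" if "y \<in> unit_square" for y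
    using that H(4) by (auto simp: unit_square_def)
  ultimately obtain Z where Z: "continuous_on (unit_square \<times> {0..1}) Z"
    "\<And>p. p \<in> unit_square \<times> {0..1} \<Longrightarrow> Z p \<noteq> 0 \<and> line_proj (?F p) (Z p) = Z p"
    "\<And>y. y \<in> unit_square \<Longrightarrow> Z (y, 0) = v0"
    "\<And>y s. y \<in> unit_square \<Longrightarrow> (\<And>s. s \<in> {0..1} \<Longrightarrow> ?F (y, s) = q0) \<Longrightarrow> s \<in> {0..1} \<Longrightarrow> Z (y, s) = v0"
    using hopf_lift[OF v0 compact_unit_square, of ?F] by blast
  define Y where "Y u t = Z ((u, fst t), snd t)" for u t
  have contY: "continuous_on unit_square (Y u)" if "u \<in> {0..1}" for u
    unfolding Y_def[abs_def] by (rule continuous_on_compose2[OF Z(1)])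
      (use that in \<open>auto simp: unit_square_def intro!: continuous_intros\<close>)
  have sides: "Y u (s, 0) = v0 \<and> Y u (0, s) = v0 \<and> Y u (1, s) = v0" if "u \<in> {0..1}" "s \<in> {0..1}" for u s
    using that Z(3)[of "(u, s)"] Z(4)[of "(u, 0)" s] Z(4)[of "(u, 1)" s] H(4)[of u]
    by (auto simp: Y_def unit_square_def)
  have lift: "square_lift (\<lambda>t. H (u, t)) (Y u)" if "u \<in> {0..1}" for u
    unfolding square_lift_def
    using contY[OF that] sides[OF that] Z(2)[of "((u, fst t), snd t)" for t] that
    by (auto simp: Y_def unit_square_def)
  have lift0: "square_lift G (Y 0)" and lift1: "square_lift G' (Y 1)"
    using lift[of 0] lift[of 1] H(3) by (auto simp: square_lift_def)
  have map: "square_map (\<lambda>t. H (u, t))" if "u \<in> {0..1}" for u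
    unfolding square_map_def
    using that H(2,4) by (auto intro!: continuous_on_compose2[OF H(1)] continuous_intros)
  let ?h = "\<lambda>p. phase (Y (fst p)) (snd p)"
  have "continuous_on ({0..1} \<times> {0..1}) ?h"
    unfolding phase_def Y_def using v0
    by (intro continuous_intros continuous_on_compose2[OF Z(1)]) (auto simp: unit_square_def)
  then have "homotopic_paths (- {0}) (phase (Y 0)) (phase (Y 1))"
    unfolding homotopic_paths
    using phase_loop[OF map lift]
    by (intro exI[of _ ?h]) (auto simp: pathstart_def pathfinish_def o_def)
  then show ?thesis
    using homotopic_paths_phase_unique[OF G V lift0] homotopic_paths_phase_unique[OF G' lift1 W]
      homotopic_paths_trans by blast
qed

end

section \<open>Extension of maps into spheres\<close>

text \<open>The cell has dimension at most that of the sphere, so no obstruction arises; this is the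
  cell complex extension theorem for a single cell. It is applied to boxes of dimension 2 and 3 and
  the unit sphere of \<open>complex \<times> complex\<close>.\<close>

lemma extend_into_sphere_from_cbox:
  fixes f :: "'a::euclidean_space \<Rightarrow> 'b::euclidean_space"
  assumes S: "closed S" "S \<subseteq> cbox a b" and dim: "DIM('a) < DIM('b)"
    and f: "continuous_on S f" "f \<in> S \<rightarrow> sphere 0 1"
  obtains g where "continuous_on (cbox a b) g" "g \<in> cbox a b \<rightarrow> sphere 0 1"
    "\<And>x. x \<in> S \<Longrightarrow> g x = f x"
proof (rule extend_map_cell_complex_to_sphere[of "{cbox a b}" S "cball 0 (1::real)" f])
  show "aff_dim X < aff_dim (cball (0::'b) 1)" if "X \<in> {cbox a b}" for X
    using aff_dim_le_DIM[of X] dim by (simp add: aff_dim_cball)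
  show "f \<in> S \<rightarrow> rel_frontier (cball 0 1)" using f(2) by (simp add: rel_frontier_cball)
qed (use S f that in \<open>auto simp: polytope_interval rel_frontier_cball face_of_refl convex_box\<close>)

text \<open>Maps to the complement of the origin are made unit by scaling, which the Hopf map ignores.\<close>
lemma extend_nonzero_from_cbox:
  fixes f :: "'a::euclidean_space \<Rightarrow> 'b::euclidean_space"
  assumes S: "closed S" "S \<subseteq> cbox a b" and dim: "DIM('a) < DIM('b)"
    and f: "continuous_on S f" "\<And>x. x \<in> S \<Longrightarrow> f x \<noteq> 0"
  obtains g where "continuous_on (cbox a b) g" "\<And>x. x \<in> cbox a b \<Longrightarrow> g x \<noteq> 0"
    "\<And>x. x \<in> S \<Longrightarrow> g x = f x /\<^sub>R norm (f x)"
proof -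
  have "continuous_on S (\<lambda>x. f x /\<^sub>R norm (f x))" "(\<lambda>x. f x /\<^sub>R norm (f x)) \<in> S \<rightarrow> sphere 0 1"
    using f by (auto intro!: continuous_intros)
  from extend_into_sphere_from_cbox[OF S dim this] obtain g where
    "continuous_on (cbox a b) g" "g \<in> cbox a b \<rightarrow> sphere 0 1" "\<And>x. x \<in> S \<Longrightarrow> g x = f x /\<^sub>R norm (f x)"
    by blast
  then show ?thesis by (intro that[of g]) force+
qed

lemma unit_square_eq_cbox: "unit_square = cbox (0, 0) (1, 1)"
  by (simp add: unit_square_def cbox_Pair_eq)

lemma hopf_normalize: "v \<noteq> 0 \<Longrightarrow> hopf (v /\<^sub>R norm v) = hopf v"
  unfolding scaleR_conv_cscale by (intro hopf_cscale) auto

context hopf_base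
begin

lemma hopf_v0: "hopf v0 = q0"
  by (rule hopf_eq[OF q0 v0])

text \<open>The two lifts, the homotopy of phases times \<open>v0\<close>, and the constant
  \<open>v0\<close> fit together to a nonvanishing map on the boundary of the 3-cube. The Hopf image
  of an extension is the desired homotopy.\<close>

lemma square_homotopicI:
  assumes G: "square_map G" and G': "square_map G'" and V: "square_lift G V" and W: "square_lift G' W"
    and "homotopic_paths (- {0}) (phase V) (phase W)"
  shows "square_homotopic G G'"
proof -
  note pV = phase_loop[OF G V] and pW = phase_loop[OF G' W]
  obtain h :: "real \<times> real \<Rightarrow> complex" where h: "continuous_on ({0..1} \<times> {0..1}) h" "h \<in> {0..1} \<times> {0..1} \<rightarrow> - {0}"
    "\<And>s. s \<in> {0..1} \<Longrightarrow> h (0, s) = phase V s" "\<And>s. s \<in> {0..1} \<Longrightarrow> h (1, s) = phase W s"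
    "\<And>u. u \<in> {0..1} \<Longrightarrow> h (u, 0) = 1 \<and> h (u, 1) = 1"
  proof -
    obtain h :: "real \<times> real \<Rightarrow> complex" where "continuous_on ({0..1} \<times> {0..1}) h" "h \<in> {0..1} \<times> {0..1} \<rightarrow> - {0}"
      "\<forall>s\<in>{0..1}. h (0, s) = phase V s" "\<forall>s\<in>{0..1}. h (1, s) = phase W s"
      "\<forall>u\<in>{0..1}. pathstart (h \<circ> Pair u) = pathstart (phase V) \<and>
        pathfinish (h \<circ> Pair u) = pathfinish (phase V)"
      using assms(5) unfolding homotopic_paths by blast
    then show ?thesis
      using pV(3,4) by (intro that[of h]) (simp_all add: pathstart_def pathfinish_def)
  qed
  have sV: "V (s, 0) = v0 \<and> V (0, s) = v0 \<and> V (1, s) = v0" and sW: "W (s, 0) = v0 \<and> W (0, s) = v0 \<and> W (1, s) = v0"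
    if "s \<in> {0..1}" for s using V W that by (auto simp: square_lift_def)
  define C :: "(real \<times> real \<times> real) set" where "C = cbox (0, 0, 0) (1, 1, 1)"
  have C: "C = {0..1} \<times> unit_square" by (simp add: C_def unit_square_def cbox_Pair_eq)
  have Ciff: "(u, s, t) \<in> C \<longleftrightarrow> u \<in> {0..1} \<and> s \<in> {0..1} \<and> t \<in> {0..1}" for u s t
    by (auto simp: C unit_square_def)
  \<comment> \<open>The boundary of the cube: the two ends of the homotopy, the side carrying the phase, and the
    three sides on which lifts are constant.\<close>
  define A where "A j = (if j = 0 then C \<inter> {p. fst p = 0} else if j = 1 then C \<inter> {p. fst p = 1}
    else if j = 2 then C \<inter> {p. snd (snd p) = 1} 
    else C \<inter> ({p. snd (snd p) = 0} \<union> {p. fst (snd p) = 0} \<union> {p. fst (snd p) = 1}))" for j :: nat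
  define B where "B = (A 0 \<union> A 1) \<union> (A 2 \<union> A 3)"
  define g where "g p = (if fst p = 0 then V (snd p) else if fst p = 1 then W (snd p)
    else if snd (snd p) = 1 then cscale (h (fst p, fst (snd p))) v0 else v0)" for p :: "real \<times> real \<times> real"
  have clA: "closed (A j)" for j
  proof -
    have "closed C" unfolding C_def by (rule closed_cbox)
    then show ?thesis
      by (auto simp: A_def intro!: closed_Int closed_Un closed_Collect_eq continuous_intros)
  qed
  \<comment> \<open>The order of the cases in \<open>g\<close> is immaterial: on every face the
    formula belonging to it is valid up to the edges, so continuity can be checked face by
    face.\<close>
  have g0: "g p = V (snd p)" if "p \<in> A 0" for p using that by (auto simp: A_def g_def)
  have g1: "g p = W (snd p)" if "p \<in> A 1" for p using that by (auto simp: A_def g_def)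
  have g2: "g p = cscale (h (fst p, fst (snd p))) v0" if "p \<in> A 2" for p
    using that pV(5) pW(5) h(3,4) by (cases p) (auto simp: A_def g_def Ciff)
  have g3: "g p = v0" if "p \<in> A 3" for p
    using that sV sW h(5) by (cases p) (auto simp: A_def g_def Ciff)
  have "continuous_on (A 0) g"
    by (subst continuous_on_cong[OF refl g0]; (rule continuous_on_compose2[of unit_square V])?)
      (use V in \<open>auto simp: A_def C square_lift_def intro!: continuous_intros\<close>)
  moreover have "continuous_on (A 1) g"
    by (subst continuous_on_cong[OF refl g1]; (rule continuous_on_compose2[of unit_square W])?)
      (use W in \<open>auto simp: A_def C square_lift_def intro!: continuous_intros\<close>)
  moreover have "continuous_on (A 2) g"
    by (subst continuous_on_cong[OF refl g2], assumption)
      (auto simp: A_def C unit_square_def intro!: continuous_intros continuous_on_compose2[OF h(1)])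
  moreover have "continuous_on (A 3) g"
    by (subst continuous_on_cong[OF refl g3], assumption) auto
  ultimately have contg: "continuous_on B g"
    unfolding B_def by (intro continuous_on_closed_Un closed_Un clA)
  have gnz: "g p \<noteq> 0" if pB: "p \<in> B" for p
  proof -
    consider "p \<in> A 0" | "p \<in> A 1" | "p \<in> A 2" | "p \<in> A 3" using pB unfolding B_def by blast
    then show ?thesis
    proof cases
      case 1 then show ?thesis using V by (auto simp: g0 A_def C square_lift_def)
    next
      case 2 then show ?thesis using W by (auto simp: g1 A_def C square_lift_def)
    next
      case 3 then show ?thesis using h(2) v0 by (auto simp: g2 A_def C unit_square_def)
    next
      case 4 then show ?thesis using v0 by (simp add: g3)
    qed
  qed
  have "closed B" unfolding B_def by (intro closed_Un clA)
  moreover have "B \<subseteq> C" by (auto simp: B_def A_def)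
  ultimately obtain Z where Z: "continuous_on C Z" "\<And>p. p \<in> C \<Longrightarrow> Z p \<noteq> 0"
    "\<And>p. p \<in> B \<Longrightarrow> Z p = g p /\<^sub>R norm (g p)"
    using extend_nonzero_from_cbox[of B "(0, 0, 0)" "(1, 1, 1)" g] contg gnz
    unfolding C_def[symmetric] by auto
  have hZ: "hopf (Z p) = hopf (g p)" if "p \<in> B" for p
    using Z(3)[OF that] gnz[OF that] hopf_normalize by simp
  have "hopf (Z (0, t)) = G t" "hopf (Z (1, t)) = G' t" if "t \<in> unit_square" for t
  proof -
    have "(0, t) \<in> A 0" "(1, t) \<in> A 1" using that by (auto simp: A_def C)
    then show "hopf (Z (0, t)) = G t" "hopf (Z (1, t)) = G' t"
      using hZ[of "(0, t)"] hZ[of "(1, t)"] g0[of "(0, t)"] g1[of "(1, t)"] that G G' V W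
        hopf_eq[of "G t" "V t"] hopf_eq[of "G' t" "W t"]
      by (auto simp: B_def square_map_def square_lift_def Pi_iff)
  qed
  \<comment> \<open>On all four sides the prescribed vector is a nonzero multiple of
    \<open>v0\<close>, so the scalar that carries the phase disappears under the Hopf map.\<close>
  moreover have "hopf (Z (u, (s, 0))) = q0 \<and> hopf (Z (u, (s, 1))) = q0 \<and>
      hopf (Z (u, (0, s))) = q0 \<and> hopf (Z (u, (1, s))) = q0" if "u \<in> {0..1}" "s \<in> {0..1}" for u s
  proof -
    have 3: "(u, s, 0) \<in> A 3" "(u, 0, s) \<in> A 3" "(u, 1, s) \<in> A 3" and 2: "(u, s, 1) \<in> A 2"
      using that by (auto simp: A_def Ciff)
    have "h (u, s) \<noteq> 0" using h(2) that by auto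
    then show ?thesis
      using 2 3 hZ[of "(u, s, 0)"] hZ[of "(u, 0, s)"] hZ[of "(u, 1, s)"] hZ[of "(u, s, 1)"]
        g3[OF 3(1)] g3[OF 3(2)] g3[OF 3(3)] g2[OF 2] hopf_v0 v0
      by (simp add: B_def hopf_cscale)
  qed
  moreover have "continuous_on C (\<lambda>p. hopf (Z p))" by (intro continuous_intros Z)
  moreover have "(\<lambda>p. hopf (Z p)) \<in> C \<rightarrow> sphere 0 1" using Z(2) norm_hopf by blast
  ultimately show ?thesis
    unfolding square_homotopic_def C by blast
qed

text \<open>The lift is constructed first, from boundary values that turn n times on one side and
  are \<open>v0\<close> on the others; the map of the square is defined as its Hopf image.\<close>

lemma square_lift_with_winding_number:
  obtains G V where "square_map G" "square_lift G V" "winding_number (phase V) 0 = of_int n"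
proof -
  define q where "q = linepath 0 (of_int n * (2 * of_real pi * \<i>))"
  define p where "p = exp \<circ> q"
  have contp: "continuous_on {0..1} p"
    using path_linepath unfolding p_def q_def path_def by (intro continuous_on_compose continuous_intros)
  have p_norm: "norm (p s) = 1" for s by (simp add: p_def q_def linepath_def)
  have e: "exp (of_int n * (2 * of_real pi * \<i>)) = 1"
    using exp_integer_2pi[of "of_int n"] by (simp add: mult_ac)
  have p01: "p 0 = 1" "p 1 = 1" using e by (simp_all add: p_def q_def linepath_def)
  have wp: "winding_number p 0 = of_int n"
    unfolding p_def by (subst winding_number_compose_exp) (auto simp: q_def)
  define A where "A = unit_square \<inter> {t. snd t = 1}"
  define B where "B = unit_square \<inter> ({t. snd t = 0} \<union> {t. fst t = 0} \<union> {t. fst t = 1})"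
  define f where "f t = (if snd t = 1 then cscale (p (fst t)) v0 else v0)" for t :: "real \<times> real"
  have cl: "closed A" "closed B"
    using compact_imp_closed[OF compact_unit_square]
    by (auto simp: A_def B_def intro!: closed_Int closed_Un closed_Collect_eq continuous_intros)
  have fA: "f t = cscale (p (fst t)) v0" if "t \<in> A" for t using that by (simp add: A_def f_def)
  have fB: "f t = v0" if "t \<in> B" for t using that p01 by (auto simp: B_def f_def)
  have "continuous_on A f"
    by (subst continuous_on_cong[OF refl fA], assumption)
      (auto simp: A_def unit_square_def intro!: continuous_intros continuous_on_compose2[OF contp])
  moreover have "continuous_on B f"
    by (subst continuous_on_cong[OF refl fB], assumption) auto
  ultimately have contf: "continuous_on (A \<union> B) f" by (intro continuous_on_closed_Un cl)
  have pnz: "p s \<noteq> 0" for s using p_norm[of s] by auto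
  have fnz: "f t \<noteq> 0" for t using v0 pnz by (simp add: f_def)
  have sub: "closed (A \<union> B)" "A \<union> B \<subseteq> unit_square" using cl by (auto simp: A_def B_def)
  obtain g where g: "continuous_on unit_square g" "\<And>t. t \<in> unit_square \<Longrightarrow> g t \<noteq> 0"
    "\<And>t. t \<in> A \<union> B \<Longrightarrow> g t = f t /\<^sub>R norm (f t)"
    using extend_nonzero_from_cbox[of "A \<union> B" "(0, 0)" "(1, 1)" f] sub contf fnz
    unfolding unit_square_eq_cbox[symmetric] by auto
  \<comment> \<open>The extension is normalised on the boundary. All prescribed values have the norm
    of \<open>v0\<close>, so one constant factor restores them.\<close>
  define V where "V t = norm v0 *\<^sub>R g t" for t
  have norm_f: "norm (f t) = norm v0" for t
    using p_norm by (simp add: f_def cscale_def norm_prod_def norm_mult)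
  have Vf: "V t = f t" if "t \<in> A \<union> B" for t
    using g(3)[OF that] v0 by (simp add: V_def norm_f)
  have contV: "continuous_on unit_square V" unfolding V_def by (intro continuous_intros g)
  have Vnz: "V t \<noteq> 0" if "t \<in> unit_square" for t using g(2)[OF that] v0 by (simp add: V_def)
  define G where "G t = hopf (V t)" for t
  have inB: "(s, 0) \<in> B" "(0, s) \<in> B" "(1, s) \<in> B" and inA: "(s, 1) \<in> A" if "s \<in> {0..1}" for s
    using that by (auto simp: A_def B_def unit_square_def)
  have VB: "V (s, 0) = v0 \<and> V (0, s) = v0 \<and> V (1, s) = v0" if "s \<in> {0..1}" for s
    using Vf fB inB[OF that] by auto
  have VA: "V (s, 1) = cscale (p s) v0" if "s \<in> {0..1}" for s
    using Vf fA inA[OF that] by auto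
  have "square_map G"
    unfolding square_map_def G_def using VA VB Vnz norm_hopf pnz v0 hopf_v0
    by (auto simp: hopf_cscale intro!: continuous_intros contV)
  moreover have "square_lift G V"
    unfolding square_lift_def G_def using VB Vnz line_proj_hopf contV by auto
  moreover have "winding_number (phase V) 0 = of_int n"
    unfolding wp[symmetric]
    by (rule winding_number_cong) (simp add: phase_def VA line_coeff_cscale v0)
  ultimately show ?thesis by (rule that)
qed

end

section \<open>The second homotopy group of the sphere\<close>

definition square_to_cube :: "real \<times> real \<Rightarrow> nat \<Rightarrow> real" where
  "square_to_cube p = (\<lambda>i\<in>{..<2}. if i = 0 then fst p else snd p)"

definition cube_to_square :: "(nat \<Rightarrow> real) \<Rightarrow> real \<times> real" where
  "cube_to_square t = (t 0, t 1)"

lemma square_to_cube_apply [simp]: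
  "square_to_cube p 0 = fst p" "square_to_cube p (Suc 0) = snd p"
  by (simp_all add: square_to_cube_def)

lemma square_to_cube_in: "p \<in> unit_square \<Longrightarrow> square_to_cube p \<in> topspace (cube 2)"
  by (auto simp: square_to_cube_def topspace_cube unit_square_def)

lemma cube_to_square_in: "t \<in> topspace (cube 2) \<Longrightarrow> cube_to_square t \<in> unit_square"
  by (auto simp: cube_to_square_def topspace_cube unit_square_def PiE_iff)

lemma cube_to_square_inverse: "cube_to_square (square_to_cube p) = p"
  by (simp add: cube_to_square_def)

lemma square_to_cube_inverse:
  assumes "t \<in> topspace (cube 2)"
  shows "square_to_cube (cube_to_square t) = t"
proof
  fix i
  show "square_to_cube (cube_to_square t) i = t i"
    using assms
    by (auto simp: square_to_cube_def cube_to_square_def topspace_cube PiE_iff extensional_def less_2_cases_iff)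
qed

lemma continuous_map_square_to_cube: "continuous_map (top_of_set unit_square) (cube 2) square_to_cube"
  unfolding continuous_map_into_cube
proof (intro conjI allI impI ballI)
  fix i :: nat assume i: "i < 2"
  show "continuous_map (top_of_set unit_square) euclideanreal (\<lambda>p. square_to_cube p i)"
    using i by (cases "i = 0") (auto simp: square_to_cube_def intro!: continuous_intros)
qed (auto simp: square_to_cube_def unit_square_def)

lemma continuous_map_cube_to_square: "continuous_map (cube 2) (top_of_set unit_square) cube_to_square"
proof -
  have "continuous_map (cube 2) (prod_topology euclideanreal euclideanreal) cube_to_square"
    unfolding cube_to_square_def[abs_def]
    by (intro continuous_map_pairedI continuous_map_cube_coordinate) auto
  then show ?thesis using cube_to_square_in by (auto simp: continuous_map_in_subtopology)
qed

lemma square_to_cube_boundary_iff: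
  assumes "p \<in> unit_square"
  shows "square_to_cube p \<in> cube_boundary 2 \<longleftrightarrow> fst p \<in> {0, 1} \<or> snd p \<in> {0, 1}"
  using square_to_cube_in[OF assms]
  by (auto simp: cube_boundary_def less_2_cases_iff)

lemma cube_to_square_boundary:
  assumes "t \<in> cube_boundary 2"
  shows "cube_to_square t \<in> unit_square \<and>
    (fst (cube_to_square t) \<in> {0, 1} \<or> snd (cube_to_square t) \<in> {0, 1})"
  using assms square_to_cube_boundary_iff[of "cube_to_square t"] subsetD[OF cube_boundary_subset assms]
  by (simp add: cube_to_square_in square_to_cube_inverse)

lemma ball_square_boundary:
  "(\<forall>p\<in>unit_square. fst p \<in> {0, 1} \<or> snd p \<in> {0, 1} \<longrightarrow> Q p) \<longleftrightarrow>
    (\<forall>s\<in>{0..1}. Q (s, 0) \<and> Q (s, 1) \<and> Q (0, s) \<and> Q (1, s))" (is "?L \<longleftrightarrow> ?R")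
proof
  assume L: ?L
  have "Q (s, 0) \<and> Q (s, 1) \<and> Q (0, s) \<and> Q (1, s)" if "s \<in> {0..1}" for s
    using L[rule_format, of "(s, 0)"] L[rule_format, of "(s, 1)"]
      L[rule_format, of "(0, s)"] L[rule_format, of "(1, s)"] that
    by (simp add: unit_square_def)
  then show ?R by blast
qed (auto simp: unit_square_def)

context hopf_base
begin

lemma square_map_iff:
  "square_map G \<longleftrightarrow> continuous_on unit_square G \<and> G \<in> unit_square \<rightarrow> sphere 0 1 \<and>
    (\<forall>p\<in>unit_square. fst p \<in> {0, 1} \<or> snd p \<in> {0, 1} \<longrightarrow> G p = q0)"
  unfolding square_map_def ball_square_boundary ..

lemma square_map_comp:
  assumes f: "f \<in> cube_maps 2 (top_of_set (sphere 0 1)) q0"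
  shows "square_map (f \<circ> square_to_cube)"
proof -
  have "continuous_map (top_of_set unit_square) (top_of_set (sphere 0 1)) (f \<circ> square_to_cube)"
    using f continuous_map_compose[OF continuous_map_square_to_cube] unfolding cube_maps_def by blast
  then show ?thesis
    using f by (auto simp: square_map_iff cube_maps_def based_map_def square_to_cube_boundary_iff)
qed

lemma cube_map_comp:
  assumes G: "square_map G"
  shows "G \<circ> cube_to_square \<in> cube_maps 2 (top_of_set (sphere 0 1)) q0"
proof -
  have "continuous_map (top_of_set unit_square) (top_of_set (sphere 0 1)) G"
    using G by (auto simp: square_map_def)
  then have "continuous_map (cube 2) (top_of_set (sphere 0 1)) (G \<circ> cube_to_square)"
    by (rule continuous_map_compose[OF continuous_map_cube_to_square])
  moreover have "G (cube_to_square t) = q0" if "t \<in> cube_boundary 2" for t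
    using G cube_to_square_boundary[OF that] unfolding square_map_iff by blast
  ultimately show ?thesis by (simp add: cube_maps_def based_map_def)
qed

lemma square_homotopic_iff:
  "square_homotopic G G' \<longleftrightarrow> (\<exists>H. continuous_on ({0..1} \<times> unit_square) H \<and>
    H \<in> {0..1} \<times> unit_square \<rightarrow> sphere 0 1 \<and>
    (\<forall>t\<in>unit_square. H (0::real, t) = G t \<and> H (1, t) = G' t) \<and>
    (\<forall>u\<in>{0..1}. \<forall>p\<in>unit_square. fst p \<in> {0, 1} \<or> snd p \<in> {0, 1} \<longrightarrow> H (u, p) = q0))"
  unfolding square_homotopic_def ball_square_boundary ..

lemma homotopic_based_2_iff:
  assumes f: "f \<in> cube_maps 2 (top_of_set (sphere 0 1)) q0"
    and g: "g \<in> cube_maps 2 (top_of_set (sphere 0 1)) q0"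
  shows "homotopic_with (based_map 2 q0) (cube 2) (top_of_set (sphere 0 1)) f g \<longleftrightarrow>
    square_homotopic (f \<circ> square_to_cube) (g \<circ> square_to_cube)"
proof
  assume "homotopic_with (based_map 2 q0) (cube 2) (top_of_set (sphere 0 1)) f g"
  then obtain h where
    h: "continuous_map (prod_topology (top_of_set {0..1::real}) (cube 2)) (top_of_set (sphere 0 1)) h"
    "\<forall>t\<in>topspace (cube 2). h (0, t) = f t" "\<forall>t\<in>topspace (cube 2). h (1, t) = g t"
    "\<forall>u\<in>{0..1}. \<forall>t\<in>cube_boundary 2. h (u, t) = q0"
    unfolding homotopic_based_iff by blast
  have "continuous_map (prod_topology (top_of_set {0..1::real}) (top_of_set unit_square))
      (prod_topology (top_of_set {0..1}) (cube 2)) (\<lambda>(u, p). (id u, square_to_cube p))"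
    unfolding continuous_map_prod_top by (simp add: continuous_map_square_to_cube)
  from continuous_map_compose[OF this h(1)]
  have "continuous_map (top_of_set ({0..1} \<times> unit_square)) (top_of_set (sphere 0 1))
      (\<lambda>p. h (fst p, square_to_cube (snd p)))"
    by (simp add: prod_topology_subtopology_eu o_def case_prod_beta)
  then show "square_homotopic (f \<circ> square_to_cube) (g \<circ> square_to_cube)"
    unfolding square_homotopic_iff using h(2-4)
    by (intro exI[of _ "\<lambda>p. h (fst p, square_to_cube (snd p))"])
      (auto simp: square_to_cube_in square_to_cube_boundary_iff)
next
  assume "square_homotopic (f \<circ> square_to_cube) (g \<circ> square_to_cube)"
  then obtain H where H: "continuous_on ({0..1} \<times> unit_square) H"
    "H \<in> {0..1} \<times> unit_square \<rightarrow> sphere 0 1"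
    "\<forall>t\<in>unit_square. H (0::real, t) = f (square_to_cube t) \<and> H (1, t) = g (square_to_cube t)"
    "\<forall>u\<in>{0..1}. \<forall>p\<in>unit_square. fst p \<in> {0, 1} \<or> snd p \<in> {0, 1} \<longrightarrow> H (u, p) = q0"
    unfolding square_homotopic_iff by auto
  have contH: "continuous_map (prod_topology (top_of_set {0..1}) (top_of_set unit_square))
      (top_of_set (sphere 0 1)) H"
    using H(1,2) by (simp add: prod_topology_subtopology_eu)
  have "continuous_map (prod_topology (top_of_set {0..1::real}) (cube 2))
      (prod_topology (top_of_set {0..1}) (top_of_set unit_square)) (\<lambda>(u, t). (id u, cube_to_square t))"
    unfolding continuous_map_prod_top by (simp add: continuous_map_cube_to_square)
  from continuous_map_compose[OF this contH]
  have "continuous_map (prod_topology (top_of_set {0..1::real}) (cube 2))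
      (top_of_set (sphere 0 1)) (\<lambda>p. H (fst p, cube_to_square (snd p)))"
    by (simp add: o_def case_prod_beta)
  then show "homotopic_with (based_map 2 q0) (cube 2) (top_of_set (sphere 0 1)) f g"
    unfolding homotopic_based_iff using H(3,4) cube_to_square_boundary
    by (intro exI[of _ "\<lambda>p. H (fst p, cube_to_square (snd p))"])
      (auto simp: cube_to_square_in square_to_cube_inverse)
qed

text \<open>Both lifts are \<open>v0\<close> on the vertical sides, hence they paste along the
  middle. The phase of the result is the join of the phases, which makes the degree
  additive.\<close>

lemma square_lift_concat:
  assumes V: "square_lift (f \<circ> square_to_cube) V" and W: "square_lift (g \<circ> square_to_cube) W"
  defines "Y \<equiv> \<lambda>p. if fst p \<le> 1 / 2 then V (2 * fst p, snd p) else W (2 * fst p - 1, snd p)"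
  shows "square_lift (cube_concat f g \<circ> square_to_cube) Y" "phase Y = phase V +++ phase W"
proof -
  have V': "continuous_on unit_square V" "\<And>t. t \<in> unit_square \<Longrightarrow> V t \<noteq> 0"
    "\<And>t. t \<in> unit_square \<Longrightarrow> line_proj (f (square_to_cube t)) (V t) = V t"
    "\<And>s. s \<in> {0..1} \<Longrightarrow> V (s, 0) = v0 \<and> V (0, s) = v0 \<and> V (1, s) = v0"
    using V by (auto simp: square_lift_def)
  have W': "continuous_on unit_square W" "\<And>t. t \<in> unit_square \<Longrightarrow> W t \<noteq> 0"
    "\<And>t. t \<in> unit_square \<Longrightarrow> line_proj (g (square_to_cube t)) (W t) = W t"
    "\<And>s. s \<in> {0..1} \<Longrightarrow> W (s, 0) = v0 \<and> W (0, s) = v0 \<and> W (1, s) = v0"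
    using W by (auto simp: square_lift_def)
  have upd: "(square_to_cube p)(0 := c) = square_to_cube (c, snd p)" for p c
    by (auto simp: square_to_cube_def)
  have conc: "(cube_concat f g \<circ> square_to_cube) p = (if fst p \<le> 1 / 2
      then f (square_to_cube (2 * fst p, snd p)) else g (square_to_cube (2 * fst p - 1, snd p)))" for p
    by (simp add: cube_concat_def upd)
  have inV: "(2 * fst p, snd p) \<in> unit_square" if "p \<in> unit_square" "fst p \<le> 1 / 2" for p
    using that by (auto simp: unit_square_def)
  have inW: "(2 * fst p - 1, snd p) \<in> unit_square" if "p \<in> unit_square" "1 / 2 \<le> fst p" for p
    using that by (auto simp: unit_square_def)
  have "continuous_on unit_square Y"
    unfolding Y_def
  proof (rule continuous_on_cases_le)
    show "continuous_on {p \<in> unit_square. fst p \<le> 1 / 2} (\<lambda>p. V (2 * fst p, snd p))"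
      using inV by (intro continuous_on_compose2[OF V'(1)] continuous_intros) auto
    show "continuous_on {p \<in> unit_square. 1 / 2 \<le> fst p} (\<lambda>p. W (2 * fst p - 1, snd p))"
      using inW by (intro continuous_on_compose2[OF W'(1)] continuous_intros) auto
    show "V (2 * fst p, snd p) = W (2 * fst p - 1, snd p)" if "p \<in> unit_square" "fst p = 1 / 2" for p
    proof -
      have "2 * fst p = 1" "snd p \<in> {0..1}" using that by (auto simp: unit_square_def)
      then show ?thesis using V'(4)[of "snd p"] W'(4)[of "snd p"] by simp
    qed
  qed (intro continuous_intros)
  moreover have "Y p \<noteq> 0 \<and> line_proj ((cube_concat f g \<circ> square_to_cube) p) (Y p) = Y p"
    if p: "p \<in> unit_square" for p
    unfolding conc using V'(2,3)[OF inV[OF p]] W'(2,3)[OF inW[OF p]] by (simp add: Y_def)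
  moreover have "Y (s, 0) = v0 \<and> Y (0, s) = v0 \<and> Y (1, s) = v0" if "s \<in> {0..1}" for s
    using V'(4)[of "2 * s"] W'(4)[of "2 * s - 1"] V'(4)[of s] W'(4)[of s] that by (simp add: Y_def)
  ultimately show "square_lift (cube_concat f g \<circ> square_to_cube) Y"
    by (simp add: square_lift_def)
  show "phase Y = phase V +++ phase W"
    by (rule ext) (simp add: phase_def Y_def joinpaths_def)
qed

lemma classified_by_degree_sphere_base: "classified_by_degree 2 (top_of_set (sphere 0 1)) q0"
proof -
  let ?M = "cube_maps 2 (top_of_set (sphere 0 1)) q0"
  \<comment> \<open>The choice is harmless: phases of any two lifts of one map are homotopic, hence
    have equal winding numbers.\<close>
  define lift where "lift f = (SOME V. square_lift (f \<circ> square_to_cube) V)" for f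
  define deg where "deg f = \<lfloor>Re (winding_number (phase (lift f)) 0)\<rfloor>" for f
  have lift: "square_lift (f \<circ> square_to_cube) (lift f)" if "f \<in> ?M" for f
    unfolding lift_def using square_lift_exists[OF square_map_comp[OF that]] by (metis someI)
  have deg: "winding_number (phase V) 0 = of_int (deg f)"
    if f: "f \<in> ?M" and V: "square_lift (f \<circ> square_to_cube) V" for f V
  proof -
    note pf = phase_loop[OF square_map_comp[OF f]]
    have "winding_number (phase V) 0 = winding_number (phase (lift f)) 0"
      using homotopic_paths_phase_unique[OF square_map_comp[OF f] V lift[OF f]]
      by (rule winding_number_homotopic_paths)
    moreover have "winding_number (phase (lift f)) 0 \<in> \<int>"
      using integer_winding_number[of "phase (lift f)" 0] pf[OF lift[OF f]] by auto
    ultimately show ?thesis by (auto simp: deg_def elim!: Ints_cases)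
  qed
  have "homotopic_with (based_map 2 q0) (cube 2) (top_of_set (sphere 0 1)) f g \<longleftrightarrow> deg f = deg g"
    if f: "f \<in> ?M" and g: "g \<in> ?M" for f g
  proof -
    note mf = square_map_comp[OF f] and mg = square_map_comp[OF g]
    note pf = phase_loop[OF mf lift[OF f]] and pg = phase_loop[OF mg lift[OF g]]
    have "homotopic_with (based_map 2 q0) (cube 2) (top_of_set (sphere 0 1)) f g \<longleftrightarrow>
        homotopic_paths (- {0}) (phase (lift f)) (phase (lift g))"
      unfolding homotopic_based_2_iff[OF f g]
      using square_homotopicI[OF mf mg lift[OF f] lift[OF g]]
        homotopic_paths_phase[OF mf mg lift[OF f] lift[OF g]] by blast
    also have "\<dots> \<longleftrightarrow> winding_number (phase (lift f)) 0 = winding_number (phase (lift g)) 0"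
      using winding_number_homotopic_paths_eq[of "phase (lift f)" 0 "phase (lift g)"] pf pg by auto
    also have "\<dots> \<longleftrightarrow> deg f = deg g"
      by (simp add: deg[OF f lift[OF f]] deg[OF g lift[OF g]])
    finally show ?thesis .
  qed
  moreover have "deg (cube_concat f g) = deg f + deg g" if f: "f \<in> ?M" and g: "g \<in> ?M" for f g
  proof -
    note pf = phase_loop[OF square_map_comp[OF f] lift[OF f]]
    note pg = phase_loop[OF square_map_comp[OF g] lift[OF g]]
    have "cube_concat f g \<in> ?M" by (rule cube_concat_in_cube_maps) (use f g in auto)
    from deg[OF this square_lift_concat(1)[OF lift[OF f] lift[OF g]]]
    have "of_int (deg (cube_concat f g)) = winding_number (phase (lift f) +++ phase (lift g)) 0"
      unfolding square_lift_concat(2)[OF lift[OF f] lift[OF g]] by (rule sym)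
    also have "\<dots> = winding_number (phase (lift f)) 0 + winding_number (phase (lift g)) 0"
      using pf pg by (intro winding_number_join) auto
    also have "\<dots> = of_int (deg f + deg g)"
      by (simp add: deg[OF f lift[OF f]] deg[OF g lift[OF g]])
    finally show ?thesis by (simp only: of_int_eq_iff)
  qed
  moreover have "\<exists>f\<in>?M. deg f = n" for n
  proof -
    obtain G V where GV: "square_map G" "square_lift G V" "winding_number (phase V) 0 = of_int n"
      by (rule square_lift_with_winding_number)
    have "G \<circ> cube_to_square \<circ> square_to_cube = G" by (auto simp: cube_to_square_inverse)
    then have "of_int (deg (G \<circ> cube_to_square)) = (of_int n :: complex)"
      using deg[OF cube_map_comp[OF GV(1)]] GV(2,3) by simp
    then show ?thesis using cube_map_comp[OF GV(1)] by (auto simp only: of_int_eq_iff)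
  qed
  ultimately show ?thesis unfolding classified_by_degree_def by blast
qed

end

lemma classified_by_degree_sphere:
  fixes q :: "complex \<times> real"
  assumes q: "q \<in> sphere 0 1"
  shows "classified_by_degree 2 (top_of_set (sphere 0 1)) q"
proof -
  obtain v where "v \<noteq> 0" "line_proj q v = v" by (rule line_nonempty[OF q])
  with q interpret hopf_base q v by unfold_locales
  show ?thesis by (rule classified_by_degree_sphere_base)
qed

section \<open>Hermitian matrices\<close>

definition herm_matrix :: "real \<times> complex \<times> real \<Rightarrow> complex^2^2" where
  "herm_matrix = (\<lambda>(a, \<zeta>, h). \<chi> i j. if i = 1 then (if j = 1 then of_real (a + h) else \<zeta>)
    else if j = 1 then cnj \<zeta> else of_real (a - h))"

definition herm_coords :: "complex^2^2 \<Rightarrow> real \<times> complex \<times> real" where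
  "herm_coords A = ((Re (A $ 1 $ 1) + Re (A $ 2 $ 2)) / 2, A $ 1 $ 2, (Re (A $ 1 $ 1) - Re (A $ 2 $ 2)) / 2)"

definition toeplitz_matrix :: "real \<times> complex \<Rightarrow> complex^2^2" where
  "toeplitz_matrix = (\<lambda>(a, \<zeta>). herm_matrix (a, \<zeta>, 0))"

definition toeplitz_coords :: "complex^2^2 \<Rightarrow> real \<times> complex" where
  "toeplitz_coords A = (Re (A $ 1 $ 1), A $ 1 $ 2)"

lemma herm_matrix_nth [simp]:
  "herm_matrix (a, \<zeta>, h) $ 1 $ 1 = of_real (a + h)" "herm_matrix (a, \<zeta>, h) $ 1 $ 2 = \<zeta>"
  "herm_matrix (a, \<zeta>, h) $ 2 $ 1 = cnj \<zeta>" "herm_matrix (a, \<zeta>, h) $ 2 $ 2 = of_real (a - h)"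
  by (simp_all add: herm_matrix_def)

lemma mat2_eq_iff:
  fixes A B :: "'a^2^2"
  shows "A = B \<longleftrightarrow> A $ 1 $ 1 = B $ 1 $ 1 \<and> A $ 1 $ 2 = B $ 1 $ 2 \<and> A $ 2 $ 1 = B $ 2 $ 1 \<and> A $ 2 $ 2 = B $ 2 $ 2"
  by (auto simp: vec_eq_iff forall_2)

lemma det_herm_matrix: "det (herm_matrix (a, v)) = of_real (a\<^sup>2 - (norm v)\<^sup>2)"
proof -
  obtain \<zeta> h where v: "v = (\<zeta>, h)" by force
  have "det (herm_matrix (a, v)) = of_real (a + h) * of_real (a - h) - \<zeta> * cnj \<zeta>"
    by (simp add: det_2 v)
  also have "\<dots> = of_real ((a + h) * (a - h) - (norm \<zeta>)\<^sup>2)"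
    by (simp only: of_real_mult of_real_diff complex_norm_square)
  also have "(a + h) * (a - h) - (norm \<zeta>)\<^sup>2 = a\<^sup>2 - (norm v)\<^sup>2"
    by (simp add: v norm_prod_def power2_eq_square algebra_simps)
  finally show ?thesis .
qed

lemma invertible_herm_matrix: "invertible (herm_matrix p) \<longleftrightarrow> p \<in> - lightlike"
proof -
  obtain a v where p: "p = (a, v)" by (meson surj_pair)
  have "a\<^sup>2 = (norm v)\<^sup>2 \<longleftrightarrow> \<bar>a\<bar> = norm v"
    using power2_eq_iff_nonneg[of "\<bar>a\<bar>" "norm v"] by simp
  then show ?thesis unfolding invertible_det_nz p det_herm_matrix
    by (simp add: lightlike_def flip: of_real_power of_real_diff)
qed

lemma herm_coords_matrix: "herm_coords (herm_matrix p) = p"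
  by (cases p) (auto simp: herm_coords_def)

lemma herm_matrix_coords:
  assumes "hermitian A"
  shows "herm_matrix (herm_coords A) = A"
proof -
  have h: "A $ i $ j = cnj (A $ j $ i)" for i j using assms unfolding hermitian_def by blast
  have "Im (A $ 1 $ 1) = 0" "Im (A $ 2 $ 2) = 0" "A $ 2 $ 1 = cnj (A $ 1 $ 2)"
    using arg_cong[OF h[of 1 1], of Im] arg_cong[OF h[of 2 2], of Im] h[of 2 1] by simp_all
  then show ?thesis
    by (simp add: mat2_eq_iff herm_coords_def complex_eq_iff add_divide_distrib diff_divide_distrib)
qed

lemma hermitian_herm_matrix: "hermitian (herm_matrix p)"
  by (cases p) (auto simp: hermitian_def forall_2)

lemma continuous_on_herm_matrix [continuous_intros]:
  assumes "continuous_on S f"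
  shows "continuous_on S (\<lambda>x. herm_matrix (f x))"
proof -
  have "continuous_on S (\<lambda>x. if i = 1 then (if j = 1 then complex_of_real (fst (f x) + snd (snd (f x))) else fst (snd (f x)))
    else if j = 1 then cnj (fst (snd (f x))) else of_real (fst (f x) - snd (snd (f x))))" for i j :: 2
    by (cases "i = 1"; cases "j = 1") (auto intro!: continuous_intros assms)
  then show ?thesis
    unfolding herm_matrix_def case_prod_beta by (intro continuous_on_vec_lambda)
qed

lemma homeomorphic_maps_herm_inv:
  "homeomorphic_maps (top_of_set herm_inv) (top_of_set (- lightlike)) herm_coords herm_matrix"
proof -
  have "continuous_on herm_inv herm_coords"
    unfolding herm_coords_def by (intro continuous_intros) auto
  moreover have "continuous_on (- lightlike) herm_matrix"
    by (intro continuous_on_herm_matrix continuous_on_id)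
  moreover have "herm_coords A \<in> - lightlike" if "A \<in> herm_inv" for A
    using that invertible_herm_matrix[of "herm_coords A"] by (simp add: herm_inv_def herm_matrix_coords)
  moreover have "herm_matrix p \<in> herm_inv" if "p \<in> - lightlike" for p
    using that by (simp add: herm_inv_def hermitian_herm_matrix invertible_herm_matrix)
  ultimately show ?thesis
    unfolding homeomorphic_maps_def
    by (auto simp: herm_coords_matrix herm_matrix_coords herm_inv_def)
qed

lemma toeplitz_herm_inv_eq: "toeplitz_herm_inv = toeplitz_matrix ` (- lightlike)"
proof -
  have "vector [vector [complex_of_real a0, complex_of_real a1 + \<i> * complex_of_real a2],
      vector [complex_of_real a1 - \<i> * complex_of_real a2, complex_of_real a0]] =
      toeplitz_matrix (a0, Complex a1 a2)" for a0 a1 a2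
    by (simp add: mat2_eq_iff toeplitz_matrix_def complex_eq_iff)
  moreover have "(\<exists>a0 a1 a2. A = toeplitz_matrix (a0, Complex a1 a2)) \<longleftrightarrow> (\<exists>p. A = toeplitz_matrix p)" for A
    by (metis complex.exhaust surj_pair)
  moreover have "invertible (toeplitz_matrix p) \<longleftrightarrow> p \<in> - lightlike" for p
    by (cases p) (simp add: toeplitz_matrix_def invertible_herm_matrix lightlike_def norm_prod_def)
  ultimately show ?thesis
    unfolding toeplitz_herm_inv_def by auto
qed

lemma toeplitz_coords_matrix: "toeplitz_coords (toeplitz_matrix p) = p"
  by (cases p) (simp add: toeplitz_coords_def toeplitz_matrix_def)

lemma homeomorphic_maps_toeplitz_herm_inv:
  "homeomorphic_maps (top_of_set toeplitz_herm_inv) (top_of_set (- lightlike)) toeplitz_coords toeplitz_matrix"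
proof -
  have "continuous_on toeplitz_herm_inv toeplitz_coords"
    unfolding toeplitz_coords_def by (intro continuous_intros)
  moreover have "continuous_on (- lightlike) toeplitz_matrix"
    unfolding toeplitz_matrix_def case_prod_beta by (intro continuous_intros)
  ultimately show ?thesis
    unfolding homeomorphic_maps_def by (auto simp: toeplitz_herm_inv_eq toeplitz_coords_matrix)
qed

lemma based_retract_homeomorphic:
  assumes "homeomorphic_maps X Y r j" "x \<in> topspace X"
  shows "based_retract X Y x r j"
proof
  show "homotopic_with (\<lambda>h. h x = x) X X id (j \<circ> r)"
    by (rule homotopic_with_equal) (use assms in \<open>auto simp: homeomorphic_maps_def\<close>)
qed (use assms in \<open>auto simp: homeomorphic_maps_def\<close>)

section \<open>Eigenvalues and signature\<close>

lemma poly_charpoly: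
  fixes A :: "complex^2^2"
  shows "poly (charpoly A) z = (z - A $ 1 $ 1) * (z - A $ 2 $ 2) - A $ 1 $ 2 * A $ 2 $ 1"
  by (simp add: charpoly_def det_2 mat_def map_matrix_def algebra_simps)

lemma poly_charpoly_herm_matrix:
  "poly (charpoly (herm_matrix (a, v))) (of_real z) = of_real ((z - a)\<^sup>2 - (norm v)\<^sup>2)"
proof -
  obtain \<zeta> h where v: "v = (\<zeta>, h)" by force
  have "poly (charpoly (herm_matrix (a, v))) (of_real z) =
      of_real (z - (a + h)) * of_real (z - (a - h)) - \<zeta> * cnj \<zeta>"
    by (simp add: poly_charpoly v)
  also have "\<dots> = of_real ((z - (a + h)) * (z - (a - h)) - (norm \<zeta>)\<^sup>2)"
    by (simp only: of_real_mult of_real_diff complex_norm_square)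
  also have "(z - (a + h)) * (z - (a - h)) - (norm \<zeta>)\<^sup>2 = (z - a)\<^sup>2 - (norm v)\<^sup>2"
    by (simp add: v norm_prod_def power2_eq_square algebra_simps)
  finally show ?thesis .
qed

lemma real_eigenvalues_herm_matrix:
  "real_eigenvalues (herm_matrix (a, v)) = {a - norm v, a + norm v}"
proof -
  obtain \<zeta> h where v: "v = (\<zeta>, h)" by force
  let ?A = "herm_matrix (a, v)"
  have eig: "?A *v w = complex_of_real x *s w \<longleftrightarrow>
      of_real (a + h) * w $ 1 + \<zeta> * w $ 2 = of_real x * w $ 1 \<and>
      cnj \<zeta> * w $ 1 + of_real (a - h) * w $ 2 = of_real x * w $ 2" for x and w :: "complex^2"
    by (simp add: vec_eq_iff forall_2 matrix_vector_mult_def sum_2 v)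
  have nv: "complex_of_real ((norm v)\<^sup>2) = \<zeta> * cnj \<zeta> + (of_real h)\<^sup>2"
    by (simp add: v norm_prod_def complex_norm_square[symmetric])
  have "x \<in> {a - norm v, a + norm v}" if "x \<in> real_eigenvalues ?A" for x
  proof -
    obtain w :: "complex^2" where w: "w \<noteq> 0" "?A *v w = complex_of_real x *s w"
      using \<open>x \<in> real_eigenvalues ?A\<close> by (auto simp: real_eigenvalues_def)
    define X H W1 W2 where "X = complex_of_real (x - a)" and "H = complex_of_real h"
      and "W1 = w $ 1" and "W2 = w $ 2"
    have e: "\<zeta> * W2 = (X - H) * W1" "cnj \<zeta> * W1 = (X + H) * W2"
      using w(2) unfolding eig by (simp_all add: X_def H_def W1_def W2_def algebra_simps)
    \<comment> \<open>Multiply the first equation by \<open>X + H\<close> and substitute the second;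
      for \<open>W2\<close>, multiply the second by \<open>X - H\<close> and substitute the
      first.\<close>
    have "(X\<^sup>2 - H\<^sup>2 - \<zeta> * cnj \<zeta>) * W1 = 0" "(X\<^sup>2 - H\<^sup>2 - \<zeta> * cnj \<zeta>) * W2 = 0"
      using e by (algebra, algebra)
    moreover have "W1 \<noteq> 0 \<or> W2 \<noteq> 0" using w(1) by (auto simp: vec_eq_iff forall_2 W1_def W2_def)
    ultimately have "X\<^sup>2 = \<zeta> * cnj \<zeta> + H\<^sup>2" by auto algebra+
    then have "complex_of_real ((x - a)\<^sup>2) = of_real ((norm v)\<^sup>2)"
      unfolding nv by (simp add: X_def H_def)
    then have "(x - a)\<^sup>2 = (norm v)\<^sup>2" by (simp only: of_real_eq_iff)
    then show ?thesis by (auto simp: power2_eq_iff)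
  qed
  moreover have "a + e \<in> real_eigenvalues ?A" if e: "e\<^sup>2 = (norm v)\<^sup>2" for e
  proof -
    have e': "\<zeta> * cnj \<zeta> = (of_real e - of_real h) * (of_real e + of_real h)"
      using nv unfolding e[symmetric] by (simp add: power2_eq_square algebra_simps)
    show ?thesis
    \<comment> \<open>The vector with entries \<zeta> and e - h is an eigenvector unless it
      vanishes; in that case the matrix is diagonal and the first unit vector serves.\<close>
    proof (cases "\<zeta> = 0 \<and> e = h")
      case True
      then show ?thesis unfolding real_eigenvalues_def mem_Collect_eq eig
        by (intro exI[of _ "vector [1, 0]"]) (auto simp: vec_eq_iff forall_2)
    next
      case False
      have "cnj \<zeta> * \<zeta> + (of_real a - of_real h) * (of_real e - of_real h) =
          (of_real a + of_real e) * (of_real e - of_real h)"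
        using e' by algebra
      with False show ?thesis unfolding real_eigenvalues_def mem_Collect_eq eig
        by (intro exI[of _ "vector [\<zeta>, of_real e - of_real h]"]) (auto simp: vec_eq_iff forall_2 algebra_simps)
    qed
  qed
  from this[of "norm v"] this[of "- norm v"] have "a - norm v \<in> real_eigenvalues ?A" "a + norm v \<in> real_eigenvalues ?A"
    by simp_all
  ultimately show ?thesis by blast
qed

lemma eigenvalue_mult_pos:
  assumes "x \<in> real_eigenvalues (herm_matrix (a, v))"
  shows "eigenvalue_mult (herm_matrix (a, v)) (of_real x) > 0"
proof -
  let ?A = "herm_matrix (a, v)"
  \<comment> \<open>A point beyond both roots shows that the characteristic polynomial is not 0, so
    that its order at a root is positive.\<close>
  have "(2 * norm v + 1) > 0" by (simp add: add_nonneg_pos)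
  moreover have "poly (charpoly ?A) (of_real (a + norm v + 1)) = of_real (2 * norm v + 1)"
    unfolding poly_charpoly_herm_matrix by (simp add: power2_eq_square algebra_simps)
  ultimately have "charpoly ?A \<noteq> 0" by (metis of_real_eq_0_iff order_less_irrefl poly_0)
  moreover have "poly (charpoly ?A) (of_real x) = 0"
    using assms unfolding poly_charpoly_herm_matrix real_eigenvalues_herm_matrix by auto
  ultimately show ?thesis unfolding eigenvalue_mult_def by (simp add: order_root)
qed

text \<open>Outside the spacelike region both eigenvalues have the same sign, and the signature is
  plus or minus a nonempty sum of positive multiplicities. This also covers \<open>v = 0\<close>,
  where the two eigenvalues coincide.\<close>

lemma signature_0_imp_spacelike:
  assumes "p \<in> - lightlike" and sig: "signature (herm_matrix p) = 0"
  shows "p \<in> spacelike"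
proof (rule ccontr)
  assume "p \<notin> spacelike"
  obtain a v where p: "p = (a, v)" by (meson surj_pair)
  let ?A = "herm_matrix (a, v)"
  let ?m = "\<lambda>x. int (eigenvalue_mult ?A (complex_of_real x))"
  let ?E = "{a - norm v, a + norm v}"
  have pos: "sum ?m S > 0" if "S = ?E" for S
    using eigenvalue_mult_pos[of _ a v] that unfolding real_eigenvalues_herm_matrix
    by (intro sum_pos) auto
  have sig': "signature ?A = sum ?m {x \<in> ?E. x > 0} - sum ?m {x \<in> ?E. x < 0}"
    unfolding signature_def real_eigenvalues_herm_matrix ..
  have "a > norm v \<or> a < - norm v"
    using assms(1) \<open>p \<notin> spacelike\<close> by (auto simp: p lightlike_def spacelike_def)
  then show False
  proof
    assume "a > norm v"
    then have E: "{x \<in> ?E. x > 0} = ?E" "{x \<in> ?E. x < 0} = {}"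
      using norm_ge_zero[of v] by (auto simp del: norm_ge_zero)
    have "sum ?m ?E = 0" using sig unfolding p sig' E by simp
    then show False using pos[OF refl] by linarith
  next
    assume "a < - norm v"
    then have E: "{x \<in> ?E. x < 0} = ?E" "{x \<in> ?E. x > 0} = {}"
      using norm_ge_zero[of v] by (auto simp del: norm_ge_zero)
    have "sum ?m ?E = 0" using sig unfolding p sig' E by simp
    then show False using pos[OF refl] by linarith
  qed
qed

section \<open>From the punctured space to the complement of the light cone\<close>

lemma classified_by_degree_nonlightlike:
  fixes x :: "real \<times> 'v::real_normed_vector"
  assumes k: "k \<ge> 1" and x: "x \<in> spacelike"
    and "classified_by_degree k (top_of_set (- {0})) (snd x)"
  shows "classified_by_degree k (top_of_set (- lightlike)) x"
  using based_retract.classified_by_degree[OF based_retract_spacelike[OF x] assms(3)]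
  by (rule classified_by_degree_component[OF k x clopen_in_nonlightlike(1,2)[of 1, simplified]])

lemma all_null_homotopic_nonlightlike:
  fixes x :: "real \<times> 'v::real_normed_vector"
  assumes k: "k \<ge> 1" and x: "x \<in> - lightlike"
    and null: "\<And>v::'v. v \<noteq> 0 \<Longrightarrow> all_null_homotopic k (top_of_set (- {0})) v"
  shows "all_null_homotopic k (top_of_set (- lightlike)) x"
proof -
  consider "x \<in> spacelike" | e where "e \<in> {1, -1::real}" "x \<in> {(a, v). norm v < e * a}"
    using x by (cases x) (force simp: spacelike_def lightlike_def abs_if split: if_splits)
  then show ?thesis
  proof cases
    case 1
    then have "snd x \<noteq> 0" by (auto simp: spacelike_def)
    from based_retract.all_null_homotopic[OF based_retract_spacelike[OF 1] null[OF this]]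
    show ?thesis
      by (rule all_null_homotopic_component[OF k 1 clopen_in_nonlightlike(1,2)[of 1, simplified]])
  next
    case 2
    show ?thesis
      by (rule all_null_homotopic_component[OF k 2(2) clopen_in_nonlightlike(3,4)[OF 2(1)]])
        (rule all_null_homotopic_convex[OF convex_timelike 2(2)])
  qed
qed

theorem mainTheorem2:
  shows
    "((\<forall>A \<in> toeplitz_herm_inv. signature A = 0 \<longrightarrow>
          homotopy_group 1 (top_of_set toeplitz_herm_inv) A \<cong> integer_group) \<and>
      (\<forall>k>1. \<forall>A \<in> toeplitz_herm_inv.
          trivial_group (homotopy_group k (top_of_set toeplitz_herm_inv) A))) \<and>
     ((\<forall>A \<in> herm_inv. trivial_group (homotopy_group 1 (top_of_set herm_inv) A)) \<and>
      (\<forall>A \<in> herm_inv. signature A = 0 \<longrightarrow>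
          homotopy_group 2 (top_of_set herm_inv) A \<cong> integer_group))"
proof (intro conjI ballI allI impI)
  fix A assume A: "A \<in> toeplitz_herm_inv" and sig: "signature A = 0"
  interpret based_retract "top_of_set toeplitz_herm_inv" "top_of_set (- lightlike)" A toeplitz_coords toeplitz_matrix
    using A by (intro based_retract_homeomorphic homeomorphic_maps_toeplitz_herm_inv) simp
  obtain a \<zeta> where p: "(a, \<zeta>) \<in> - lightlike" "A = toeplitz_matrix (a, \<zeta>)"
    using A by (auto simp: toeplitz_herm_inv_eq)
  \<comment> \<open>The signature lemma is stated for all hermitian matrices; a Toeplitz matrix
    enters it with third coordinate 0.\<close>
  then have "(a, \<zeta>, 0::real) \<in> spacelike"
    using sig by (intro signature_0_imp_spacelike) (auto simp: toeplitz_matrix_def lightlike_def norm_prod_def)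
  then have sp: "(a, \<zeta>) \<in> spacelike" by (simp add: spacelike_def norm_prod_def)
  then have "\<zeta> \<noteq> 0" by (auto simp: spacelike_def)
  from classified_by_degree_punctured_plane[OF this]
  have "classified_by_degree 1 (top_of_set (- lightlike)) (a, \<zeta>)"
    by (intro classified_by_degree_nonlightlike[OF _ sp]) simp_all
  then have "classified_by_degree 1 (top_of_set toeplitz_herm_inv) A"
    by (intro classified_by_degree) (simp add: p toeplitz_coords_matrix)
  then show "homotopy_group 1 (top_of_set toeplitz_herm_inv) A \<cong> integer_group"
    by (intro homotopy_group_iso_integer_group) auto
next
  fix k :: nat and A assume k: "k > 1" and A: "A \<in> toeplitz_herm_inv"
  interpret based_retract "top_of_set toeplitz_herm_inv" "top_of_set (- lightlike)" A toeplitz_coords toeplitz_matrix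
    using A by (intro based_retract_homeomorphic homeomorphic_maps_toeplitz_herm_inv) simp
  have "toeplitz_coords A \<in> - lightlike"
    using A by (auto simp: toeplitz_herm_inv_eq toeplitz_coords_matrix)
  then have "all_null_homotopic k (top_of_set toeplitz_herm_inv) A"
    using k by (intro all_null_homotopic all_null_homotopic_nonlightlike all_null_homotopic_punctured_plane) auto
  then show "trivial_group (homotopy_group k (top_of_set toeplitz_herm_inv) A)"
    using k A by (intro trivial_homotopy_group) auto
next
  fix A assume A: "A \<in> herm_inv"
  interpret based_retract "top_of_set herm_inv" "top_of_set (- lightlike)" A herm_coords herm_matrix
    using A by (intro based_retract_homeomorphic homeomorphic_maps_herm_inv) simp
  have "herm_coords A \<in> - lightlike" using cont_r A by (auto simp: continuous_map_def)
  moreover have "all_null_homotopic 1 (top_of_set (- {0})) v" if "v \<noteq> 0" for v :: "complex \<times> real"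
  proof -
    \<comment> \<open>\<open>complex \<times> real\<close> has real dimension 3, so its unit sphere
      is simply connected.\<close>
    have "simply_connected (sphere (0::complex \<times> real) 1)" by (rule simply_connected_sphere) simp
    then have "all_null_homotopic 1 (top_of_set (sphere 0 1)) (v /\<^sub>R norm v)"
      using that by (intro all_null_homotopic_simply_connected) auto
    then show ?thesis by (rule based_retract.all_null_homotopic[OF based_retract_sphere[OF that]])
  qed
  ultimately have "all_null_homotopic 1 (top_of_set herm_inv) A"
    by (intro all_null_homotopic all_null_homotopic_nonlightlike) auto
  then show "trivial_group (homotopy_group 1 (top_of_set herm_inv) A)"
    using A by (intro trivial_homotopy_group) auto
next
  fix A assume A: "A \<in> herm_inv" and sig: "signature A = 0"
  interpret based_retract "top_of_set herm_inv" "top_of_set (- lightlike)" A herm_coords herm_matrix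
    using A by (intro based_retract_homeomorphic homeomorphic_maps_herm_inv) simp
  have p: "herm_coords A \<in> - lightlike" using cont_r A by (auto simp: continuous_map_def)
  have sp: "herm_coords A \<in> spacelike"
    using p sig A by (intro signature_0_imp_spacelike) (auto simp: herm_inv_def herm_matrix_coords)
  define v where "v = snd (herm_coords A)"
  have v: "v \<noteq> 0" using sp by (auto simp: spacelike_def v_def case_prod_beta)
  have "classified_by_degree 2 (top_of_set (sphere 0 1)) (v /\<^sub>R norm v)"
    using v by (intro classified_by_degree_sphere) simp
  then have "classified_by_degree 2 (top_of_set (- {0})) v"
    by (rule based_retract.classified_by_degree[OF based_retract_sphere[OF v]])
  then have "classified_by_degree 2 (top_of_set herm_inv) A"
    unfolding v_def using sp by (intro classified_by_degree classified_by_degree_nonlightlike) auto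
  then show "homotopy_group 2 (top_of_set herm_inv) A \<cong> integer_group"
    by (intro homotopy_group_iso_integer_group) auto
qed

end
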